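(* Let $a>b\geq 1$ be integers. For each $B$ there is a constant $N=N(a,b,B)$ depending only on $a$, $b$ and $B$ with the following property: if $U\subset Q(a,b)$ is a (nonempty) connected open set and $f\colon U\to Q(A,B)$ is a real-analytic CR mapping such that $f(U)$ does not lie in a complex hyperplane of $\mathbb{C}^{A+B}$, then $$A\leq N(a,b,B).$$
   Context: For nonnegative integers $a,b$, the hyperquadric is $$Q(a,b)=\Bigl\{z\in\mathbb{C}^{a+b}:\sum_{j=1}^a|z_j|^2-\sum_{j=a+1}^{a+b}|z_j|^2=1\Bigr\}.$$ "Open" means relatively open in $Q(a,b)$. A real-analytic CR mapping $f\colon U\to Q(A,B)$ is the restriction to $U$ of a holomorphic mapping from a neighborhood of $U$ in $\mathbb{C}^{a+b}$ to $\mathbb{C}^{A+B}$ that takes $U$ into $Q(A,B)$. A complex hyperplane is a complex affine subspace of complex codimension one. *)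

theory Defs
  imports "HOL-Analysis.Analysis" "HOL-Library.Function_Algebras"
begin

text \<open>The target dimension is quantified inside the theorem, so it cannot be a type. The space
  \<open>\<complex>\<^sup>n\<close> is therefore the set of sequences supported on \<open>{..<n}\<close>. On this set the product
  topology of \<^typ>\<open>nat \<Rightarrow> complex\<close> induces the usual topology. The coordinates
  \<open>z\<^sub>1, \<dots>, z\<^sub>n\<close> are \<open>z 0, \<dots>, z (n - 1)\<close>.\<close>

definition cspace :: "nat \<Rightarrow> (nat \<Rightarrow> complex) set" where
  "cspace n = {z. \<forall>i\<ge>n. z i = 0}"

definition hyperquadric :: "nat \<Rightarrow> nat \<Rightarrow> (nat \<Rightarrow> complex) set" where
  "hyperquadric a b =
     {z \<in> cspace (a + b). (\<Sum>j<a. (cmod (z j))\<^sup>2) - (\<Sum>j=a..<a + b. (cmod (z j))\<^sup>2) = 1}"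

text \<open>Complex (Frechet) differentiability at every point of \<open>W\<close>, where \<open>W\<close> is meant to be
  relatively open in \<^term>\<open>cspace n\<close>; the derivative at \<open>p\<close> is the complex linear form with
  coefficients \<open>c 0, \<dots>, c (n - 1)\<close>. The class-based \<^const>\<open>has_derivative\<close> does not apply,
  since \<^typ>\<open>nat \<Rightarrow> complex\<close> carries no norm.\<close>

definition holomorphic_fun :: "nat \<Rightarrow> (nat \<Rightarrow> complex) set \<Rightarrow> ((nat \<Rightarrow> complex) \<Rightarrow> complex) \<Rightarrow> bool" where
  "holomorphic_fun n W g \<longleftrightarrow>
     (\<forall>p\<in>W. \<exists>c :: nat \<Rightarrow> complex.
        ((\<lambda>z. (g z - g p - (\<Sum>j<n. c j * (z j - p j)))
               / of_real (L2_set (\<lambda>j. cmod (z j - p j)) {..<n})) \<longlongrightarrow> 0) (at p within W))"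

definition holomorphic_map ::
    "nat \<Rightarrow> nat \<Rightarrow> (nat \<Rightarrow> complex) set \<Rightarrow> ((nat \<Rightarrow> complex) \<Rightarrow> (nat \<Rightarrow> complex)) \<Rightarrow> bool" where
  "holomorphic_map n m W F \<longleftrightarrow>
     F ` W \<subseteq> cspace m \<and> (\<forall>k<m. holomorphic_fun n W (\<lambda>z. F z k))"

text \<open>Only the values of \<open>f\<close> on \<open>U\<close> matter.\<close>

definition real_analytic_CR_map ::
    "nat \<Rightarrow> nat \<Rightarrow> nat \<Rightarrow> nat \<Rightarrow> (nat \<Rightarrow> complex) set
       \<Rightarrow> ((nat \<Rightarrow> complex) \<Rightarrow> (nat \<Rightarrow> complex)) \<Rightarrow> bool" where
  "real_analytic_CR_map a b A B U f \<longleftrightarrow>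
     (\<exists>W F. openin (top_of_set (cspace (a + b))) W \<and> U \<subseteq> W \<and>
            holomorphic_map (a + b) (A + B) W F \<and> (\<forall>z\<in>U. F z = f z)) \<and>
     f ` U \<subseteq> hyperquadric A B"

definition cscale :: "complex \<Rightarrow> (nat \<Rightarrow> complex) \<Rightarrow> (nat \<Rightarrow> complex)" where
  "cscale c z = (\<lambda>i. c * z i)"

global_interpretation cvec: vector_space cscale
  by unfold_locales (simp_all add: cscale_def fun_eq_iff algebra_simps)

definition complex_hyperplane :: "nat \<Rightarrow> (nat \<Rightarrow> complex) set \<Rightarrow> bool" where
  "complex_hyperplane m H \<longleftrightarrow>
     (\<exists>p V. p \<in> cspace m \<and> cvec.subspace V \<and> V \<subseteq> cspace m \<and> cvec.dim V + 1 = cvec.dim (cspace m) \<and>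
            H = (+) p ` V)"

end

theory Submission
  imports Defs "HOL-Complex_Analysis.Complex_Analysis" "Jordan_Normal_Form.Determinant"
begin

text \<open>Let \<open>F\<close> extend \<open>f\<close> holomorphically. If a complex line lies in \<open>Q(a,b)\<close>, then polarizing
  \<open>\<langle>F, F\<rangle> = 1\<close> along it shows that the vectors \<open>(F, 1)\<close> are isotropic for a form with \<open>B + 1\<close>
  negative squares. Hence any \<open>B + 2\<close> of them are dependent, which is the vanishing of certain
  minors. These minors depend holomorphically on the line, and the lines in \<open>Q(a,b)\<close> are a
  uniqueness set in the space of lines: if \<open>q, w, u\<close> are orthogonal with
  \<open>\<langle>w, w\<rangle> = - \<langle>u, u\<rangle>\<close> and \<open>\<langle>q, q\<rangle> > 0\<close>, then \<open>\<alpha> q + t (w + \<beta> u)\<close> is such a line for all \<open>\<alpha>, \<beta>\<close> on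
  two circles, while \<open>\<alpha> = 1, \<beta> = 0\<close> gives an arbitrary line near a base line. So the minors
  vanish on all lines near a base line.

  In linear coordinates whose axes are parallel to such lines, every affine function of \<open>F\<close> is
  then determined on each coordinate line by its values at \<open>B + 1\<close> points, and therefore on a
  polydisc by its values at \<open>(B + 1)\<^sup>a\<^sup>+\<^sup>b\<close> points. If \<open>A + B + 1\<close> exceeds this number, some nonzero
  affine function of \<open>F\<close> vanishes on the polydisc, hence on the connected set \<open>U\<close>.\<close>

section \<open>Minors and determining sets\<close>

definition minor :: "nat \<Rightarrow> (nat \<Rightarrow> nat \<Rightarrow> complex) \<Rightarrow> complex" where
  "minor n M = det (mat n n (\<lambda>(i, j). M i j))"

lemma minor_0 [simp]: "minor 0 M = 1"
  by (simp add: minor_def)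

lemma minor_cong:
  assumes "\<And>i j. i < n \<Longrightarrow> j < n \<Longrightarrow> M i j = M' i j"
  shows "minor n M = minor n M'"
  unfolding minor_def by (rule arg_cong[where f = det]) (auto simp: assms)

text \<open>Laplace expansion along the last row. It serves both to border a nonzero minor and to
  see that a zero last row kills the determinant.\<close>

lemma minor_Suc_last_row:
  assumes "\<And>j. j < n \<Longrightarrow> M n j = 0"
  shows "minor (Suc n) M = M n n * minor n M"
proof -
  let ?A = "mat (Suc n) (Suc n) (\<lambda>(i, j). M i j)"
  have "mat_delete ?A n n = mat n n (\<lambda>(i, j). M i j)"
    by (rule eq_matI) (auto simp: mat_delete_def)
  then have "cofactor ?A n n = minor n M"
    by (simp add: cofactor_def minor_def)
  then show ?thesis
    unfolding minor_def by (subst laplace_expansion_row[of _ "Suc n" n]) (auto simp: assms)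
qed

lemma minor_eq_0_iff:
  "minor n M = 0 \<longleftrightarrow> (\<exists>c. (\<exists>j<n. c j \<noteq> 0) \<and> (\<forall>i<n. (\<Sum>j<n. M i j * c j) = 0))"
    (is "_ \<longleftrightarrow> ?R")
proof -
  let ?A = "mat n n (\<lambda>(i, j). M i j)"
  have *: "?A *\<^sub>v v = 0\<^sub>v n \<longleftrightarrow> (\<forall>i<n. (\<Sum>j<n. M i j * vec_index v j) = 0)"
    if "v \<in> carrier_vec n" for v
  proof -
    have "dim_vec v = n"
      using that by simp
    then show ?thesis
      by (auto simp: vec_eq_iff scalar_prod_def lessThan_atLeast0)
  qed
  have "minor n M = 0 \<longleftrightarrow> (\<exists>v. v \<in> carrier_vec n \<and> v \<noteq> 0\<^sub>v n \<and> ?A *\<^sub>v v = 0\<^sub>v n)"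
    unfolding minor_def by (rule det_0_iff_vec_prod_zero_field) simp
  also have "\<dots> \<longleftrightarrow> ?R"
  proof
    assume "\<exists>v. v \<in> carrier_vec n \<and> v \<noteq> 0\<^sub>v n \<and> ?A *\<^sub>v v = 0\<^sub>v n"
    then obtain v where v: "v \<in> carrier_vec n" "v \<noteq> 0\<^sub>v n" "?A *\<^sub>v v = 0\<^sub>v n"
      by blast
    then have "\<exists>j<n. vec_index v j \<noteq> 0"
      by (auto simp: vec_eq_iff)
    with v * show ?R
      by blast
  next
    assume ?R
    then obtain c where c: "\<exists>j<n. c j \<noteq> 0" "\<forall>i<n. (\<Sum>j<n. M i j * c j) = 0"
      by blast
    have "vec n c \<noteq> 0\<^sub>v n"
      using c(1) by (auto simp: vec_eq_iff)
    moreover have "?A *\<^sub>v vec n c = 0\<^sub>v n"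
      using c(2) by (subst *) (auto intro!: sum.cong)
    ultimately show "\<exists>v. v \<in> carrier_vec n \<and> v \<noteq> 0\<^sub>v n \<and> ?A *\<^sub>v v = 0\<^sub>v n"
      by (intro exI[of _ "vec n c"]) auto
  qed
  finally show ?thesis .
qed

text \<open>Zero rows pad the \<open>k\<close> equations to a square system. Its last row is zero,
  so its determinant vanishes and it has a kernel vector.\<close>

lemma underdetermined_system:
  fixes M :: "nat \<Rightarrow> nat \<Rightarrow> complex"
  assumes "k < n"
  obtains c where "\<exists>j<n. c j \<noteq> 0" "\<And>i. i < k \<Longrightarrow> (\<Sum>j<n. M i j * c j) = 0"
proof -
  obtain l where l: "n = Suc l"
    using assms by (cases n) auto
  define M' where "M' i j = (if i < k then M i j else 0)" for i j
  have "minor n M' = 0"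
    unfolding l by (subst minor_Suc_last_row) (use assms l in \<open>auto simp: M'_def\<close>)
  then obtain c where c: "\<exists>j<n. c j \<noteq> 0" "\<forall>i<n. (\<Sum>j<n. M' i j * c j) = 0"
    unfolding minor_eq_0_iff by blast
  have "(\<Sum>j<n. M i j * c j) = 0" if "i < k" for i
    using c(2)[rule_format, of i] that assms by (simp add: M'_def)
  with c(1) show ?thesis
    using that by blast
qed

lemma holomorphic_on_minor:
  assumes "\<And>i j. i < n \<Longrightarrow> j < n \<Longrightarrow> (\<lambda>t. M t i j) holomorphic_on D"
  shows "(\<lambda>t. minor n (M t)) holomorphic_on D"
proof -
  have "minor n (M t) =
      (\<Sum>p | p permutes {0..<n}. signof p * (\<Prod>i = 0..<n. M t i (p i)))" for t
    unfolding minor_def det_def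
    by (auto intro!: sum.cong prod.cong arg_cong2[where f = "(*)"] simp: permutes_in_image)
  moreover have "(\<lambda>t. \<Sum>p | p permutes {0..<n}. signof p * (\<Prod>i = 0..<n. M t i (p i)))
      holomorphic_on D"
    by (intro holomorphic_intros assms) (auto simp: permutes_in_image)
  ultimately show ?thesis
    by simp
qed

section \<open>Separately holomorphic functions on a product domain\<close>

definition polydomain :: "nat \<Rightarrow> complex set \<Rightarrow> (nat \<Rightarrow> complex) set" where
  "polydomain n D = {x \<in> cspace n. \<forall>i<n. x i \<in> D}"

definition separately_holomorphic :: "nat \<Rightarrow> complex set \<Rightarrow> ((nat \<Rightarrow> complex) \<Rightarrow> complex) \<Rightarrow> bool" where
  "separately_holomorphic n D h \<longleftrightarrow>
     (\<forall>x\<in>polydomain n D. \<forall>i<n. (\<lambda>t. h (x(i := t))) holomorphic_on D)"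

lemma polydomain_upd:
  "x \<in> polydomain n D \<Longrightarrow> i < n \<Longrightarrow> t \<in> D \<Longrightarrow> x(i := t) \<in> polydomain n D"
  by (auto simp: polydomain_def cspace_def)

lemma polydomain_extend:
  "x \<in> polydomain n D \<Longrightarrow> t \<in> D \<Longrightarrow> x(n := t) \<in> polydomain (Suc n) D"
  by (auto simp: polydomain_def cspace_def less_Suc_eq)

lemma polydomain_restrict:
  "x \<in> polydomain (Suc n) D \<Longrightarrow> x(n := 0) \<in> polydomain n D"
  by (auto simp: polydomain_def cspace_def le_Suc_eq)

lemma polydomain_0 [simp]: "polydomain 0 D = {\<lambda>_. 0}"
  by (auto simp: polydomain_def cspace_def)

lemma separately_holomorphic_slice:
  assumes "separately_holomorphic (Suc n) D h" "t \<in> D"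
  shows "separately_holomorphic n D (\<lambda>x. h (x(n := t)))"
  unfolding separately_holomorphic_def
proof (intro ballI allI impI)
  fix x i assume x: "x \<in> polydomain n D" "i < n"
  have "(\<lambda>s. h ((x(n := t))(i := s))) holomorphic_on D"
    using assms x(2) polydomain_extend[OF x(1) assms(2)]
    unfolding separately_holomorphic_def by (blast intro: less_SucI)
  moreover have "(x(n := t))(i := s) = (x(i := s))(n := t)" for s
    using x(2) by (intro fun_upd_twist) auto
  ultimately show "(\<lambda>s. h ((x(i := s))(n := t))) holomorphic_on D"
    by (simp only:)
qed

text \<open>\<open>f\<close> is nonzero on a nonempty open set; if \<open>g\<close> vanished there,
  the identity theorem would make it vanish on all of \<open>D\<close>.\<close>

lemma holomorphic_on_common_nonzero:
  assumes "open D" "connected D" "f holomorphic_on D" "g holomorphic_on D"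
    and "x \<in> D" "f x \<noteq> 0" "y \<in> D" "g y \<noteq> 0"
  shows "\<exists>t\<in>D. f t \<noteq> 0 \<and> g t \<noteq> 0"
proof (rule ccontr)
  assume none: "\<not> (\<exists>t\<in>D. f t \<noteq> 0 \<and> g t \<noteq> 0)"
  let ?T = "D \<inter> f -` (- {0})"
  have "open ?T"
    by (rule continuous_open_preimage[OF holomorphic_on_imp_continuous_on])
      (use assms in \<open>auto simp: open_delete\<close>)
  moreover have "x \<in> ?T"
    using assms by auto
  ultimately have limpt: "x islimpt ?T"
    by (intro interior_limit_point) (simp only: interior_open)
  have "g t = 0" if "t \<in> ?T" for t
    using none that by auto
  then have "g y = 0"
    by (rule analytic_continuation[OF assms(4,1,2) _ \<open>x \<in> D\<close> limpt _ \<open>y \<in> D\<close>, rotated]) auto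
  with assms show False
    by simp
qed

text \<open>Induction on the number of variables. The slice of \<open>h1\<close> at
  \<open>x n\<close> and that of \<open>h2\<close> at \<open>y n\<close> are nonzero at a common
  \<open>z\<close>; on the line through \<open>z\<close> parallel to the last axis neither function
  is identically zero, and the one-variable case applies.\<close>

lemma separately_holomorphic_common_nonzero:
  assumes "open D" "connected D"
    and "separately_holomorphic n D h1" "separately_holomorphic n D h2"
    and "x \<in> polydomain n D" "h1 x \<noteq> 0" "y \<in> polydomain n D" "h2 y \<noteq> 0"
  shows "\<exists>z\<in>polydomain n D. h1 z \<noteq> 0 \<and> h2 z \<noteq> 0"
  using assms(3-)
proof (induction n arbitrary: h1 h2 x y)
  case 0
  then show ?case by simp
next
  case (Suc n)
  have D: "x n \<in> D" "y n \<in> D"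
    using Suc.prems by (auto simp: polydomain_def)
  have "\<exists>z\<in>polydomain n D. h1 (z(n := x n)) \<noteq> 0 \<and> h2 (z(n := y n)) \<noteq> 0"
  proof (rule Suc.IH)
    show "x(n := 0) \<in> polydomain n D" "y(n := 0) \<in> polydomain n D"
      using Suc.prems polydomain_restrict by blast+
    show "h1 ((x(n := 0))(n := x n)) \<noteq> 0" "h2 ((y(n := 0))(n := y n)) \<noteq> 0"
      using Suc.prems by (simp_all only: fun_upd_upd fun_upd_triv not_False_eq_True)
  qed (use Suc.prems D separately_holomorphic_slice in blast)+
  then obtain z where z: "z \<in> polydomain n D" "h1 (z(n := x n)) \<noteq> 0" "h2 (z(n := y n)) \<noteq> 0"
    by blast
  have "(\<lambda>t. h (z(n := t))) holomorphic_on D" if "separately_holomorphic (Suc n) D h" for h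
  proof -
    have "(\<lambda>t. h ((z(n := x n))(n := t))) holomorphic_on D"
      using that polydomain_extend[OF z(1) D(1)] unfolding separately_holomorphic_def by blast
    then show ?thesis by simp
  qed
  from holomorphic_on_common_nonzero[OF assms(1,2) this[OF Suc.prems(1)] this[OF Suc.prems(2)]
      D(1) z(2) D(2) z(3)]
  obtain t where "t \<in> D" "h1 (z(n := t)) \<noteq> 0" "h2 (z(n := t)) \<noteq> 0"
    by blast
  then show ?case
    using polydomain_extend[OF z(1)] by blast
qed

text \<open>The minor condition says that the restrictions of \<open>\<F>\<close> to any coordinate
  line have rank at most \<open>r\<close>. In the induction one set of at most \<open>r\<close>
  nodes on the last axis serves all lines parallel to that axis, and each node contributes a slice
  with one variable less; hence the product bound.\<close>

lemma determining_set:
  assumes D: "open D" "connected D" "D \<noteq> {}"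
    and hol: "\<And>g. g \<in> \<F> \<Longrightarrow> separately_holomorphic n D g"
    and rank: "\<And>x i gs ts. x \<in> polydomain n D \<Longrightarrow> i < n \<Longrightarrow> (\<And>j. gs j \<in> \<F>) \<Longrightarrow>
      (\<And>j. ts j \<in> D) \<Longrightarrow> minor (Suc r) (\<lambda>j k. gs j (x(i := ts k))) = 0"
  shows "\<exists>S. S \<subseteq> polydomain n D \<and> finite S \<and> card S \<le> r ^ n \<and>
    (\<forall>g\<in>\<F>. (\<forall>x\<in>S. g x = 0) \<longrightarrow> (\<forall>x\<in>polydomain n D. g x = 0))"
  using hol rank
proof (induction n arbitrary: \<F>)
  case 0
  then show ?case
    by (intro exI[of _ "{\<lambda>_. 0}"]) auto
next
  case (Suc n)
  show ?case
  proof (cases "\<F> = {}")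
    case True
    then show ?thesis by (intro exI[of _ "{}"]) auto
  next
    case False
    then obtain g0 where g0: "g0 \<in> \<F>" by blast
    obtain t0 where t0: "t0 \<in> D" using D by blast
    \<comment> \<open>If a minor of maximal size \<open>k\<close> with nodes \<open>ts\<close> on the last axis is nonzero at \<open>y0\<close>, then
      bordering it with \<open>g\<close> shows that \<open>g\<close> vanishes as soon as it does on the \<open>k\<close> slices at \<open>ts\<close>.\<close>
    define P where "P k \<longleftrightarrow> (\<exists>gs ts y. (\<forall>j. gs j \<in> \<F>) \<and> (\<forall>j. ts j \<in> D) \<and> y \<in> polydomain n D \<and>
       minor k (\<lambda>j k. gs j (y(n := ts k))) \<noteq> 0)" for k
    have "(\<lambda>i. if i < n then t0 else 0) \<in> polydomain n D"
      using t0 by (auto simp: polydomain_def cspace_def)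
    then have P0: "P 0"
      unfolding P_def using g0 t0
      by (intro exI[of _ "\<lambda>_. g0"] exI[of _ "\<lambda>_. t0"] exI[of _ "\<lambda>i. if i < n then t0 else 0"]) auto
    \<comment> \<open>Filling coordinate \<open>n\<close> of \<open>y\<close> with \<open>t0\<close>
      gives a point to which the rank hypothesis applies; the update by \<open>ts k\<close> then
      erases \<open>t0\<close>.\<close>
    have "\<not> P (Suc r)"
    proof
      assume "P (Suc r)"
      then obtain gs ts y where *: "\<forall>j. gs j \<in> \<F>" "\<forall>j. ts j \<in> D" "y \<in> polydomain n D"
         "minor (Suc r) (\<lambda>j k. gs j (y(n := ts k))) \<noteq> 0"
        unfolding P_def by blast
      have "minor (Suc r) (\<lambda>j k. gs j ((y(n := t0))(n := ts k))) = 0"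
        by (rule Suc.prems(2)[OF polydomain_extend[OF *(3) t0]]) (use * in auto)
      with * show False by simp
    qed
    \<comment> \<open>\<open>k\<close> is the predecessor of the least size violating
      \<open>P\<close>. That size is positive because the empty minor is 1.\<close>
    then obtain k where k: "P k" "\<not> P (Suc k)" "k \<le> r"
    proof -
      define l where "l = (LEAST j. \<not> P j)"
      have l: "\<not> P l" "l \<le> Suc r"
        using \<open>\<not> P (Suc r)\<close> LeastI[of "\<lambda>j. \<not> P j"] Least_le[of "\<lambda>j. \<not> P j"]
        unfolding l_def by simp_all
      then obtain k where "l = Suc k"
        using P0 by (cases l) auto
      moreover have "P k"
        using not_less_Least[of k "\<lambda>j. \<not> P j"] \<open>l = Suc k\<close> by (auto simp: l_def)
      ultimately show ?thesis
        using that l by auto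
    qed
    from k(1) obtain gs ts y0 where gs: "\<And>j. gs j \<in> \<F>" and ts: "\<And>j. ts j \<in> D"
      and y0: "y0 \<in> polydomain n D" "minor k (\<lambda>j k. gs j (y0(n := ts k))) \<noteq> 0"
      unfolding P_def by blast
    define h where "h y = minor k (\<lambda>j k. gs j (y(n := ts k)))" for y
    have h_hol: "separately_holomorphic n D h"
    proof (unfold separately_holomorphic_def, intro ballI allI impI)
      fix x i assume xi: "x \<in> polydomain n D" "i < n"
      show "(\<lambda>t. h (x(i := t))) holomorphic_on D"
        unfolding h_def
      proof (rule holomorphic_on_minor)
        fix j l
        have "separately_holomorphic n D (\<lambda>x. gs j (x(n := ts l)))"
          by (rule separately_holomorphic_slice[OF Suc.prems(1)[OF gs] ts])
        then show "(\<lambda>t. gs j ((x(i := t))(n := ts l))) holomorphic_on D"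
          using xi unfolding separately_holomorphic_def by blast
      qed
    qed
    \<comment> \<open>Slices of \<open>\<F>\<close> through the node \<open>ts j\<close>. A
      coordinate line inside a slice is a coordinate line of the full product, so the rank bound
      \<open>r\<close> is inherited.\<close>
    define \<G> where "\<G> j = (\<lambda>g x. g (x(n := ts j))) ` \<F>" for j
    have "\<exists>S. S \<subseteq> polydomain n D \<and> finite S \<and> card S \<le> r ^ n \<and>
      (\<forall>g\<in>\<G> j. (\<forall>x\<in>S. g x = 0) \<longrightarrow> (\<forall>x\<in>polydomain n D. g x = 0))" for j
    proof (rule Suc.IH)
      show "separately_holomorphic n D g" if gG: "g \<in> \<G> j" for g
      proof -
        obtain g' where "g' \<in> \<F>" "g = (\<lambda>x. g' (x(n := ts j)))"
          using gG unfolding \<G>_def by blast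
        then show ?thesis
          by (simp only: separately_holomorphic_slice[OF Suc.prems(1) ts])
      qed
      fix x i and fs :: "nat \<Rightarrow> (nat \<Rightarrow> complex) \<Rightarrow> complex" and us :: "nat \<Rightarrow> complex"
      assume *: "x \<in> polydomain n D" "i < n" "\<And>l. fs l \<in> \<G> j" "\<And>l. us l \<in> D"
      then have "\<forall>l. \<exists>g\<in>\<F>. fs l = (\<lambda>x. g (x(n := ts j)))"
        by (auto simp: \<G>_def)
      then obtain fs' where fs': "\<And>l. fs' l \<in> \<F>" "\<And>l. fs l = (\<lambda>x. fs' l (x(n := ts j)))"
        by metis
      have "minor (Suc r) (\<lambda>l k. fs' l ((x(n := ts j))(i := us k))) = 0"
        by (rule Suc.prems(2)[OF polydomain_extend[OF *(1) ts]]) (use * fs' in auto)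
      moreover have "(x(n := ts j))(i := s) = (x(i := s))(n := ts j)" for s
        using \<open>i < n\<close> by (intro fun_upd_twist) auto
      ultimately show "minor (Suc r) (\<lambda>l k. fs l (x(i := us k))) = 0"
        by (simp only: fs'(2))
    qed
    then obtain T where T': "\<And>j. T j \<subseteq> polydomain n D \<and> finite (T j) \<and> card (T j) \<le> r ^ n \<and>
      (\<forall>g\<in>\<G> j. (\<forall>x\<in>T j. g x = 0) \<longrightarrow> (\<forall>x\<in>polydomain n D. g x = 0))"
      using choice[of "\<lambda>j S. S \<subseteq> polydomain n D \<and> finite S \<and> card S \<le> r ^ n \<and>
      (\<forall>g\<in>\<G> j. (\<forall>x\<in>S. g x = 0) \<longrightarrow> (\<forall>x\<in>polydomain n D. g x = 0))"] by blast
    then have T: "\<And>j. T j \<subseteq> polydomain n D" "\<And>j. finite (T j)" "\<And>j. card (T j) \<le> r ^ n"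
      and det: "\<And>j g x. g \<in> \<G> j \<Longrightarrow> (\<forall>x\<in>T j. g x = 0) \<Longrightarrow> x \<in> polydomain n D \<Longrightarrow> g x = 0"
      by blast+
    define S where "S = (\<Union>j<k. (\<lambda>x. x(n := ts j)) ` T j)"
    have "S \<subseteq> polydomain (Suc n) D"
      unfolding S_def using T(1) polydomain_extend ts by blast
    moreover have "finite S"
      unfolding S_def using T(2) by auto
    moreover have "card S \<le> r ^ Suc n"
    proof -
      have "card S \<le> (\<Sum>j<k. card ((\<lambda>x. x(n := ts j)) ` T j))"
        unfolding S_def by (rule card_UN_le) simp
      also have "\<dots> \<le> (\<Sum>j<k. r ^ n)"
        using T card_image_le order_trans by (intro sum_mono) blast
      also have "\<dots> \<le> r ^ Suc n"
        using k(3) by simp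
      finally show ?thesis .
    qed
    moreover have "g x = 0" if g: "g \<in> \<F>" "\<forall>x\<in>S. g x = 0" and x: "x \<in> polydomain (Suc n) D" for g x
    proof (rule ccontr)
      assume "g x \<noteq> 0"
      have xn: "x n \<in> D" using x by (auto simp: polydomain_def)
      have vanish: "g (y(n := ts j)) = 0" if "y \<in> polydomain n D" "j < k" for y j
      proof -
        have "(\<lambda>x. g (x(n := ts j))) \<in> \<G> j" using g by (auto simp: \<G>_def)
        moreover have "\<forall>x\<in>T j. g (x(n := ts j)) = 0"
          using g(2) that by (auto simp: S_def)
        ultimately show ?thesis
          using det that by blast
      qed
      \<comment> \<open>Neither the minor \<open>h\<close> nor the slice of \<open>g\<close> through
        \<open>x\<close> is identically zero, so there is a point where both are nonzero. There the
        bordered minor is their product, against the maximality of \<open>k\<close>.\<close>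
      have "\<exists>z\<in>polydomain n D. h z \<noteq> 0 \<and> g (z(n := x n)) \<noteq> 0"
      proof (rule separately_holomorphic_common_nonzero[OF D(1,2) h_hol])
        show "separately_holomorphic n D (\<lambda>z. g (z(n := x n)))"
          by (rule separately_holomorphic_slice[OF Suc.prems(1)[OF g(1)] xn])
        show "g ((x(n := 0))(n := x n)) \<noteq> 0"
          using \<open>g x \<noteq> 0\<close> by (simp only: fun_upd_upd fun_upd_triv not_False_eq_True)
      qed (use y0 polydomain_restrict[OF x] in \<open>auto simp only: h_def\<close>)
      then obtain z where z: "z \<in> polydomain n D" "h z \<noteq> 0" "g (z(n := x n)) \<noteq> 0"
        by blast
      let ?gs = "gs(k := g)" and ?ts = "ts(k := x n)"
      have "minor (Suc k) (\<lambda>i j. ?gs i (z(n := ?ts j)))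
          = g (z(n := x n)) * minor k (\<lambda>i j. ?gs i (z(n := ?ts j)))"
        using vanish[OF z(1)] by (subst minor_Suc_last_row) auto
      also have "minor k (\<lambda>i j. ?gs i (z(n := ?ts j))) = h z"
        unfolding h_def by (rule minor_cong) auto
      finally have eq: "minor (Suc k) (\<lambda>i j. ?gs i (z(n := ?ts j))) = g (z(n := x n)) * h z"
        by (simp only: fun_upd_same)
      have "minor (Suc k) (\<lambda>i j. ?gs i (z(n := ?ts j))) \<noteq> 0"
        unfolding eq using z by simp
      then have "P (Suc k)"
        unfolding P_def using gs ts g(1) xn z(1)
        by (intro exI[of _ ?gs] exI[of _ ?ts] exI[of _ z]) auto
      with k(2) show False by simp
    qed
    ultimately show ?thesis
      by blast
  qed
qed

section \<open>Holomorphic functions on lines and on quadrics\<close>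

text \<open>Chain rule for an affine line: the derivative is the complex linear form at the point,
  applied to \<open>y\<close>. The constant line is split off, since the limit defining the linear
  form is only usable along points different from the base point.\<close>

lemma holomorphic_fun_line:
  assumes g: "holomorphic_fun n W g" and W: "W \<subseteq> cspace n"
    and T: "open T" "\<And>t. t \<in> T \<Longrightarrow> (\<lambda>j. x j + t * y j) \<in> W"
  shows "(\<lambda>t. g (\<lambda>j. x j + t * y j)) holomorphic_on T"
proof (cases "y = (\<lambda>_. 0)")
  case True
  then show ?thesis by simp
next
  case False
  define \<gamma> where "\<gamma> t = (\<lambda>j. x j + t * y j)" for t
  have \<gamma>W: "\<gamma> t \<in> W" if "t \<in> T" for t
    using T(2)[OF that] by (simp add: \<gamma>_def)
  have inj: "\<gamma> t \<noteq> \<gamma> s" if "t \<noteq> s" for t s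
    using False that by (auto simp: \<gamma>_def fun_eq_iff)
  have cont: "continuous_on T \<gamma>"
    unfolding \<gamma>_def by (intro continuous_on_coordinatewise_then_product continuous_intros)
  define L where "L = L2_set (\<lambda>j. cmod (y j)) {..<n}"
  have "((\<lambda>t. g (\<gamma> t)) has_field_derivative D) (at s)"
    if s: "s \<in> T"
      and c: "((\<lambda>z. (g z - g (\<gamma> s) - (\<Sum>j<n. c j * (z j - \<gamma> s j)))
               / of_real (L2_set (\<lambda>j. cmod (z j - \<gamma> s j)) {..<n})) \<longlongrightarrow> 0) (at (\<gamma> s) within W)"
      and D: "D = (\<Sum>j<n. c j * y j)"
    for s c D
  proof -
    have Ts: "\<forall>\<^sub>F t in at s. t \<in> T \<and> t \<noteq> s"
      using s T(1) eventually_at_topological by fastforce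
    \<comment> \<open>\<open>L\<close> sees only the first \<open>n\<close> coordinates of
      \<open>y\<close>. The remaining ones vanish because two distinct points of the line lie in
      \<open>cspace n\<close>.\<close>
    have "L \<noteq> 0"
    proof
      assume "L = 0"
      then have "y j = 0" if "j < n" for j
        using that by (simp add: L_def L2_set_eq_0_iff)
      moreover have "y j = 0" if "j \<ge> n" for j
      proof -
        obtain t where "t \<in> T" "t \<noteq> s"
          using eventually_happens[OF Ts] by auto
        then have "\<gamma> t j = 0" "\<gamma> s j = 0"
          using \<gamma>W s W \<open>j \<ge> n\<close> unfolding cspace_def by blast+
        then have "t * y j = s * y j"
          by (simp add: \<gamma>_def add_eq_0_iff)
        then show ?thesis
          using \<open>t \<noteq> s\<close> by simp
      qed
      ultimately have "y j = 0" for j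
        by (cases "j < n") auto
      then show False
        using False by (simp add: fun_eq_iff)
    qed
    have L2: "L2_set (\<lambda>j. cmod (\<gamma> t j - \<gamma> s j)) {..<n} = cmod (t - s) * L" for t
      unfolding L_def by (subst L2_set_right_distrib) (auto simp: \<gamma>_def norm_mult[symmetric] algebra_simps)
    have lin: "(\<Sum>j<n. c j * (\<gamma> t j - \<gamma> s j)) = (t - s) * D" for t
      unfolding D sum_distrib_left by (intro sum.cong) (auto simp: \<gamma>_def algebra_simps)
    have "filterlim \<gamma> (at (\<gamma> s) within W) (at s)"
      unfolding filterlim_at
    proof
      show "(\<gamma> \<longlongrightarrow> \<gamma> s) (at s)"
        using cont s T(1) by (simp add: continuous_on_eq_continuous_at isCont_def)
      show "\<forall>\<^sub>F t in at s. \<gamma> t \<in> W \<and> \<gamma> t \<noteq> \<gamma> s"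
        using Ts by eventually_elim (use \<gamma>W inj in blast)
    qed
    then have "((\<lambda>t. (g (\<gamma> t) - g (\<gamma> s) - (t - s) * D) / of_real (cmod (t - s) * L)) \<longlongrightarrow> 0) (at s)"
      using filterlim_compose[OF c, of \<gamma> "at s"] unfolding L2 lin by simp
    \<comment> \<open>The step from \<open>\<gamma> s\<close> to \<open>\<gamma> t\<close> has
      length \<open>cmod (t - s) * L\<close>. Hence \<open>L\<close> times the norm of the Frechet
      quotient is exactly the error of the one-variable difference quotient.\<close>
    then have "((\<lambda>t. L * norm ((g (\<gamma> t) - g (\<gamma> s) - (t - s) * D) / of_real (cmod (t - s) * L))) \<longlongrightarrow> 0) (at s)"
      by (intro tendsto_mult_right_zero tendsto_norm_zero)
    moreover have "\<forall>\<^sub>F t in at s. L * norm ((g (\<gamma> t) - g (\<gamma> s) - (t - s) * D) / of_real (cmod (t - s) * L))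
        = norm ((g (\<gamma> t) - g (\<gamma> s)) / (t - s) - D)"
      using Ts
    proof eventually_elim
      case (elim t)
      have "(g (\<gamma> t) - g (\<gamma> s)) / (t - s) - D = (g (\<gamma> t) - g (\<gamma> s) - (t - s) * D) / (t - s)"
        using elim by (simp add: field_simps)
      moreover have "L \<ge> 0"
        by (simp add: L_def L2_set_nonneg)
      ultimately show ?case
        using \<open>L \<noteq> 0\<close> by (simp add: norm_divide norm_mult)
    qed
    ultimately have "((\<lambda>t. norm ((g (\<gamma> t) - g (\<gamma> s)) / (t - s) - D)) \<longlongrightarrow> 0) (at s)"
      by (rule Lim_transform_eventually)
    from LIM_zero_cancel[OF tendsto_norm_zero_cancel[OF this]] show ?thesis
      unfolding has_field_derivative_iff .
  qed
  note * = this
  have "\<exists>D. ((\<lambda>t. g (\<gamma> t)) has_field_derivative D) (at s)" if sT: "s \<in> T" for s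
  proof -
    obtain c where "((\<lambda>z. (g z - g (\<gamma> s) - (\<Sum>j<n. c j * (z j - \<gamma> s j)))
               / of_real (L2_set (\<lambda>j. cmod (z j - \<gamma> s j)) {..<n})) \<longlongrightarrow> 0) (at (\<gamma> s) within W)"
      using g \<gamma>W[OF sT] unfolding holomorphic_fun_def by blast
    from *[OF sT this refl] show ?thesis
      by blast
  qed
  then show ?thesis
    unfolding \<gamma>_def[symmetric] using T(1) by (simp add: holomorphic_on_open)
qed

text \<open>The part of the circle inside \<open>S\<close> already accumulates at \<open>c\<close>,
  so the identity theorem applies even if \<open>S\<close> contains only an arc.\<close>

lemma holomorphic_zero_on_circle:
  assumes f: "f holomorphic_on S" "open S" "connected S"
    and c: "complex_of_real c \<in> S" "c > 0"
    and zero: "\<And>t. t \<in> S \<Longrightarrow> cmod t = c \<Longrightarrow> f t = 0"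
    and "s \<in> S"
  shows "f s = 0"
proof -
  have "complex_of_real c islimpt sphere 0 c"
  proof (rule connected_imp_perfect)
    show "connected (sphere (0::complex) c)"
      by (rule connected_sphere) simp
    have "- complex_of_real c \<noteq> complex_of_real c"
      using c(2) by (simp add: complex_eq_iff)
    then show "sphere (0::complex) c \<noteq> {x}" for x
      using c(2) by (metis mem_sphere_0 norm_minus_cancel norm_of_real abs_of_pos singletonD)
  qed (use c in auto)
  then have limpt: "complex_of_real c islimpt (S \<inter> sphere 0 c)"
    unfolding islimpt_def using f(2) c(1) by (metis Int_iff open_Int)
  show ?thesis
    by (rule analytic_continuation[OF f _ c(1) limpt _ \<open>s \<in> S\<close>]) (use zero in auto)
qed

lemma holomorphic_zero_on_reals:
  assumes f: "f holomorphic_on ball 0 \<rho>"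
    and zero: "\<And>t::real. \<bar>t\<bar> < \<rho> \<Longrightarrow> f (of_real t) = 0"
    and s: "s \<in> ball 0 \<rho>"
  shows "f s = 0"
proof -
  have "\<rho> > 0"
    using s by (auto intro: le_less_trans[OF norm_ge_zero])
  have limpt: "(0::complex) islimpt of_real ` {-\<rho><..<\<rho>}"
  proof (rule connected_imp_perfect)
    show "connected (complex_of_real ` {-\<rho><..<\<rho>})"
      by (intro connected_continuous_image continuous_intros) auto
    have "complex_of_real 0 \<in> of_real ` {-\<rho><..<\<rho>}" "complex_of_real (\<rho>/2) \<in> of_real ` {-\<rho><..<\<rho>}"
      using \<open>\<rho> > 0\<close> by (intro imageI; simp)+
    then show "complex_of_real ` {-\<rho><..<\<rho>} \<noteq> {x}" for x
      using \<open>\<rho> > 0\<close> by (metis of_real_eq_iff singletonD half_gt_zero less_irrefl)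
    show "(0::complex) \<in> of_real ` {-\<rho><..<\<rho>}"
      using \<open>\<rho> > 0\<close> by (intro image_eqI[of _ _ 0]) auto
  qed
  show ?thesis
    by (rule analytic_continuation[OF f _ _ _ _ limpt _ s]) (use zero \<open>\<rho> > 0\<close> in auto)
qed

text \<open>Put \<open>t = x + \<i> * y\<close> and \<open>cnj s = x - \<i> * y\<close>. The sum
  becomes holomorphic in \<open>x\<close> and in \<open>y\<close>, and real \<open>x\<close>,
  \<open>y\<close> correspond to the diagonal \<open>s = t\<close>. Uniqueness from the reals, first
  in \<open>x\<close> and then in \<open>y\<close>, gives all pairs.\<close>

lemma hermitian_polarization:
  fixes f :: "nat \<Rightarrow> complex \<Rightarrow> complex" and \<epsilon> :: "nat \<Rightarrow> complex"
  assumes f: "\<And>k. k < m \<Longrightarrow> f k holomorphic_on ball 0 \<rho>"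
    and diag: "\<And>t. t \<in> ball 0 \<rho> \<Longrightarrow> (\<Sum>k<m. \<epsilon> k * f k t * cnj (f k t)) = C"
    and t: "t \<in> ball 0 (\<rho> / 2)" and s: "s \<in> ball 0 (\<rho> / 2)"
  shows "(\<Sum>k<m. \<epsilon> k * f k t * cnj (f k s)) = C"
proof -
  let ?B = "ball (0::complex) (\<rho> / 2)"
  \<comment> \<open>Conjugating both argument and value turns the antiholomorphic factor into a
    holomorphic function of \<open>cnj s\<close>.\<close>
  define g where "g k t = cnj (f k (cnj t))" for k t
  have g: "g k holomorphic_on ball 0 \<rho>" if "k < m" for k
  proof -
    have "cnj ` ball 0 \<rho> = ball 0 \<rho>"
      by (auto simp: image_iff intro!: bexI[of _ "cnj _"])
    then have "cnj \<circ> f k \<circ> cnj holomorphic_on ball 0 \<rho>"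
      using f[OF that] by (intro holomorphic_on_compose_cnj_cnj) auto
    then show ?thesis
      by (simp add: g_def[abs_def] o_def)
  qed
  define K where "K x y = (\<Sum>k<m. \<epsilon> k * f k (x + \<i> * y) * g k (x - \<i> * y)) - C" for x y
  \<comment> \<open>Halving the radius keeps both \<open>x + \<i> * y\<close> and
    \<open>x - \<i> * y\<close> inside the original disc.\<close>
  have ball: "x + \<i> * y \<in> ball 0 \<rho>" "x - \<i> * y \<in> ball 0 \<rho>" if "x \<in> ?B" "y \<in> ?B" for x y
  proof -
    have "cmod x + cmod (\<i> * y) < \<rho>"
      using that by (simp add: norm_mult)
    then show "x + \<i> * y \<in> ball 0 \<rho>" "x - \<i> * y \<in> ball 0 \<rho>"
      using norm_triangle_ineq[of x "\<i> * y"] norm_triangle_ineq4[of x "\<i> * y"] by simp_all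
  qed
  have hol: "(\<lambda>x. f k (h x)) holomorphic_on ?B" "(\<lambda>x. g k (h x)) holomorphic_on ?B"
    if "k < m" "h holomorphic_on ?B" "h ` ?B \<subseteq> ball 0 \<rho>" for k h
    using holomorphic_on_compose_gen[OF that(2) f[OF that(1)] that(3)]
      holomorphic_on_compose_gen[OF that(2) g[OF that(1)] that(3)] by (simp_all add: o_def)
  have K_real: "K (of_real x) (of_real y) = 0" if "\<bar>x\<bar> < \<rho> / 2" "\<bar>y\<bar> < \<rho> / 2" for x y
  proof -
    have "cnj (of_real x - \<i> * of_real y) = of_real x + \<i> * of_real y"
      by simp
    moreover have "of_real x + \<i> * of_real y \<in> ball 0 \<rho>"
      using that by (intro ball) auto
    ultimately show ?thesis
      unfolding K_def g_def using diag by simp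
  qed
  have K_x: "K x (of_real y) = 0" if "x \<in> ?B" "\<bar>y\<bar> < \<rho> / 2" for x y
  proof (rule holomorphic_zero_on_reals[of "\<lambda>x. K x (of_real y)"])
    show "(\<lambda>x. K x (of_real y)) holomorphic_on ?B"
      unfolding K_def using that ball
      by (intro holomorphic_intros hol) auto
  qed (use that K_real in auto)
  have K_xy: "K x y = 0" if "x \<in> ?B" "y \<in> ?B" for x y
  proof (rule holomorphic_zero_on_reals[of "K x"])
    show "K x holomorphic_on ?B"
      unfolding K_def using that ball
      by (intro holomorphic_intros hol) auto
  qed (use that K_x in auto)
  define x y where "x = (t + cnj s) / 2" and "y = (t - cnj s) / (2 * \<i>)"
  have "cmod t + cmod s < \<rho>"
    using t s by simp
  then have "x \<in> ?B" "y \<in> ?B"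
    using norm_triangle_ineq[of t "cnj s"] norm_triangle_ineq4[of t "cnj s"]
    by (simp_all add: x_def y_def norm_divide norm_mult)
  then have "K x y = 0"
    by (rule K_xy)
  moreover have "x + \<i> * y = t" "x - \<i> * y = cnj s"
    by (simp_all add: x_def y_def field_simps)
  ultimately show ?thesis
    by (simp add: K_def g_def)
qed

section \<open>The Hermitian form of a hyperquadric and isotropic families\<close>

definition hform :: "nat \<Rightarrow> nat \<Rightarrow> (nat \<Rightarrow> complex) \<Rightarrow> (nat \<Rightarrow> complex) \<Rightarrow> complex" where
  "hform a b x y = (\<Sum>j<a + b. (if j < a then 1 else - 1) * x j * cnj (y j))"

lemma hform_split:
  "hform a b x y = (\<Sum>j<a. x j * cnj (y j)) - (\<Sum>j=a..<a + b. x j * cnj (y j))"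
proof -
  have "hform a b x y = (\<Sum>j<a. (if j < a then 1 else - 1) * x j * cnj (y j))
      + (\<Sum>j=a..<a + b. (if j < a then 1 else - 1) * x j * cnj (y j))"
    unfolding hform_def lessThan_atLeast0
    by (rule sum.atLeastLessThan_concat[symmetric]) auto
  also have "(\<Sum>j=a..<a + b. (if j < a then 1 else - 1) * x j * cnj (y j))
      = - (\<Sum>j=a..<a + b. x j * cnj (y j))"
    by (simp add: sum_negf)
  finally show ?thesis
    by simp
qed

lemma hform_diag:
  "hform a b x x = of_real ((\<Sum>j<a. (cmod (x j))\<^sup>2) - (\<Sum>j=a..<a + b. (cmod (x j))\<^sup>2))"
  by (simp add: hform_split complex_norm_square[symmetric])

lemma hyperquadric_iff: "z \<in> hyperquadric a b \<longleftrightarrow> z \<in> cspace (a + b) \<and> hform a b z z = 1"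
  unfolding hyperquadric_def hform_diag using of_real_eq_1_iff by blast

lemma hform_lincomb_left:
  "hform a b (\<lambda>k. \<Sum>i\<in>I. c i * v i k) y = (\<Sum>i\<in>I. c i * hform a b (v i) y)"
  unfolding hform_def sum_distrib_left sum_distrib_right
  by (subst sum.swap) (simp add: mult_ac)

lemma hform_cnj: "cnj (hform a b x y) = hform a b y x"
  unfolding hform_def by (simp add: mult_ac) (intro sum.cong; simp)

lemma hform_add_left: "hform a b (\<lambda>j. x j + x' j) y = hform a b x y + hform a b x' y"
  unfolding hform_def sum.distrib[symmetric] by (intro sum.cong) (auto simp: algebra_simps)

lemma hform_diff_left: "hform a b (\<lambda>j. x j - x' j) y = hform a b x y - hform a b x' y"
  unfolding hform_def sum_subtractf[symmetric] by (intro sum.cong) (auto simp: algebra_simps)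

lemma hform_scale_left: "hform a b (\<lambda>j. c * x j) y = c * hform a b x y"
  unfolding hform_def sum_distrib_left by (intro sum.cong) (auto simp: algebra_simps)

lemma hform_add_right: "hform a b x (\<lambda>j. y j + y' j) = hform a b x y + hform a b x y'"
  unfolding hform_def sum.distrib[symmetric] by (intro sum.cong) (auto simp: algebra_simps)

lemma hform_diff_right: "hform a b x (\<lambda>j. y j - y' j) = hform a b x y - hform a b x y'"
  unfolding hform_def sum_subtractf[symmetric] by (intro sum.cong) (auto simp: algebra_simps)

lemma hform_scale_right: "hform a b x (\<lambda>j. c * y j) = cnj c * hform a b x y"
  unfolding hform_def sum_distrib_left by (intro sum.cong) (auto simp: algebra_simps)

lemmas hform_simps = hform_add_left hform_diff_left hform_scale_left
  hform_add_right hform_diff_right hform_scale_right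

text \<open>The vectors \<open>(v i, 1)\<close> are pairwise orthogonal and isotropic for
  \<open>hform A B\<close> minus the product of the last coordinates, a form with
  \<open>B + 1\<close> negative squares. Some nontrivial combination kills these
  \<open>B + 1\<close> coordinates; it is isotropic without a negative part, hence zero.\<close>

lemma isotropic_family_dependent:
  assumes gram: "\<And>i j. i < B + 2 \<Longrightarrow> j < B + 2 \<Longrightarrow> hform A B (v i) (v j) = 1"
  shows "\<exists>c. (\<exists>j<B + 2. c j \<noteq> 0) \<and> (\<Sum>j<B + 2. c j) = 0 \<and>
    (\<forall>k<A + B. (\<Sum>j<B + 2. c j * v j k) = 0)"
proof -
  \<comment> \<open>Rows below \<open>B\<close> are the negative coordinates, row \<open>B\<close>
    is the appended coordinate 1.\<close>
  obtain c where c: "\<exists>j<B + 2. c j \<noteq> 0"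
    "\<And>i. i < B + 1 \<Longrightarrow> (\<Sum>j<B + 2. (if i < B then v j (A + i) else 1) * c j) = 0"
    using underdetermined_system[of "B + 1" "B + 2" "\<lambda>i j. if i < B then v j (A + i) else 1"] by auto
  define s where "s k = (\<Sum>j<B + 2. c j * v j k)" for k
  have sum0: "(\<Sum>j<B + 2. c j) = 0"
    using c(2)[of B] by simp
  have neg: "s k = 0" if "k \<in> {A..<A + B}" for k
  proof -
    have "s k = (\<Sum>j<B + 2. (if k - A < B then v j (A + (k - A)) else 1) * c j)"
      unfolding s_def using that by (intro sum.cong) auto
    then show ?thesis
      using c(2)[of "k - A"] that by auto
  qed
  have s_left: "hform A B s x = (\<Sum>j<B + 2. c j * hform A B (v j) x)" for x
    unfolding s_def by (rule hform_lincomb_left)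
  have s_right: "hform A B (v i) s = 0" if "i < B + 2" for i
  proof -
    have "hform A B s (v i) = (\<Sum>j<B + 2. c j)"
      unfolding s_left using gram that by (intro sum.cong) auto
    then show ?thesis
      using sum0 hform_cnj[of A B s "v i"] by simp
  qed
  have "hform A B s s = (\<Sum>j<B + 2. c j * hform A B (v j) s)"
    by (rule s_left)
  also have "\<dots> = 0"
    using s_right by simp
  finally have "(\<Sum>j<A. (cmod (s j))\<^sup>2) - (\<Sum>j=A..<A + B. (cmod (s j))\<^sup>2) = 0"
    unfolding hform_diag of_real_eq_0_iff .
  then have "(\<Sum>j<A. (cmod (s j))\<^sup>2) = 0"
    using neg by simp
  then have "s k = 0" if "k < A + B" for k
    using that neg by (cases "k < A") (auto simp: sum_nonneg_eq_0_iff)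
  then show ?thesis
    using c(1) sum0 by (intro exI[of _ c]) (simp only: s_def, blast)
qed

text \<open>The entry \<open>c m\<close> is the constant term, so the form is a linear form with
  \<open>m + 1\<close> coefficients in the vector \<open>(w, 1)\<close>.\<close>

definition affine_form :: "nat \<Rightarrow> (nat \<Rightarrow> complex) \<Rightarrow> (nat \<Rightarrow> complex) \<Rightarrow> complex" where
  "affine_form m c w = c m + (\<Sum>k<m. c k * w k)"

text \<open>A linear dependence among the vectors \<open>(v j, 1)\<close> is a kernel vector of
  every matrix of affine forms evaluated at the \<open>v j\<close>.\<close>

lemma minor_affine_form_isotropic:
  assumes "\<And>i j. i < B + 2 \<Longrightarrow> j < B + 2 \<Longrightarrow> hform A B (v i) (v j) = 1"
  shows "minor (B + 2) (\<lambda>i j. affine_form (A + B) (c i) (v j)) = 0"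
proof -
  have "\<exists>d. (\<exists>j<B + 2. d j \<noteq> 0) \<and> (\<Sum>j<B + 2. d j) = 0 \<and>
    (\<forall>k<A + B. (\<Sum>j<B + 2. d j * v j k) = 0)"
    by (rule isotropic_family_dependent) (rule assms)
  then obtain d where d: "\<exists>j<B + 2. d j \<noteq> 0" "(\<Sum>j<B + 2. d j) = 0"
    "\<forall>k<A + B. (\<Sum>j<B + 2. d j * v j k) = 0"
    by blast
  have "(\<Sum>j<B + 2. affine_form (A + B) e (v j) * d j) = 0" for e
  proof -
    have "affine_form (A + B) e (v j) * d j = e (A + B) * d j + (\<Sum>k<A + B. e k * (d j * v j k))" for j
      unfolding affine_form_def distrib_right sum_distrib_right by (simp add: mult_ac)
    then have "(\<Sum>j<B + 2. affine_form (A + B) e (v j) * d j)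
        = e (A + B) * (\<Sum>j<B + 2. d j) + (\<Sum>j<B + 2. \<Sum>k<A + B. e k * (d j * v j k))"
      by (simp only: sum.distrib sum_distrib_left)
    also have "(\<Sum>j<B + 2. \<Sum>k<A + B. e k * (d j * v j k)) = (\<Sum>k<A + B. e k * (\<Sum>j<B + 2. d j * v j k))"
      unfolding sum_distrib_left by (rule sum.swap)
    finally show ?thesis
      using d(2,3) by simp
  qed
  then show ?thesis
    unfolding minor_eq_0_iff using d(1) by blast
qed

text \<open>On the line with parameters \<open>\<alpha>\<close>, \<open>\<beta>\<close> the form at
  \<open>t\<close> is \<open>M\<close> times the square of \<open>cmod \<alpha>\<close>, plus
  \<open>N\<close> times the square of \<open>cmod t\<close> times
  \<open>1 - (cmod \<beta>)\<^sup>2\<close>. It is 1 for all \<open>t\<close> when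
  \<open>cmod \<alpha> = 1 / sqrt M\<close> and \<open>cmod \<beta> = 1\<close>, and then
  polarization makes the minor vanish. Continuation in \<open>\<alpha>\<close> and then in
  \<open>\<beta>\<close> reaches \<open>\<alpha> = 1\<close>, \<open>\<beta> = 0\<close>.\<close>

lemma minor_on_complexified_line:
  assumes W: "W \<subseteq> cspace (a + b)" and q: "q \<in> cspace (a + b)" and w: "w \<in> cspace (a + b)"
    and u: "u \<in> cspace (a + b)"
    and F: "\<And>k. k < A + B \<Longrightarrow> holomorphic_fun (a + b) W (\<lambda>z. F z k)"
    and FQ: "\<And>z. z \<in> W \<Longrightarrow> hform a b z z = 1 \<Longrightarrow> hform A B (F z) (F z) = 1"
    and orth: "hform a b q w = 0" "hform a b q u = 0" "hform a b w u = 0"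
    and M: "hform a b q q = of_real M" "M > 0"
    and N: "hform a b w w = of_real N" "hform a b u u = - of_real N"
    and \<rho>': "\<bar>1 / sqrt M - 1\<bar> < \<rho>'"
    and mem: "\<And>\<alpha> \<beta> t. \<alpha> \<in> ball 1 \<rho>' \<Longrightarrow> \<beta> \<in> ball 0 2 \<Longrightarrow> t \<in> ball 0 \<rho> \<Longrightarrow>
        (\<lambda>j. \<alpha> * q j + t * (w j + \<beta> * u j)) \<in> W"
    and ts: "\<And>j. ts j \<in> ball 0 (\<rho> / 2)"
  shows "minor (B + 2) (\<lambda>i j. affine_form (A + B) (c i) (F (\<lambda>l. q l + ts j * w l))) = 0"
proof -
  define \<Delta> where "\<Delta> \<alpha> \<beta> = minor (B + 2)
     (\<lambda>i j. affine_form (A + B) (c i) (F (\<lambda>l. \<alpha> * q l + ts j * (w l + \<beta> * u l))))" for \<alpha> \<beta>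
  have ts': "ts j \<in> ball 0 \<rho>" for j
  proof -
    have "2 * cmod (ts j) < \<rho>"
      using ts[of j] by simp
    then show ?thesis
      using norm_ge_zero[of "ts j"] unfolding mem_ball_0 by linarith
  qed
  have orth': "hform a b w q = 0" "hform a b u q = 0" "hform a b u w = 0"
    using orth hform_cnj[of a b q w] hform_cnj[of a b q u] hform_cnj[of a b w u] by simp_all
  have on_quadric: "\<Delta> \<alpha> \<beta> = 0"
    if \<alpha>: "\<alpha> \<in> ball 1 \<rho>'" "cmod \<alpha> = 1 / sqrt M" and \<beta>: "\<beta> \<in> ball 0 2" "cmod \<beta> = 1" for \<alpha> \<beta>
  proof -
    define \<gamma> where "\<gamma> t = (\<lambda>l. \<alpha> * q l + t * (w l + \<beta> * u l))" for t
    have \<gamma>W: "\<gamma> t \<in> W" if "t \<in> ball 0 \<rho>" for t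
      unfolding \<gamma>_def by (rule mem[OF \<alpha>(1) \<beta>(1) that])
    have "\<alpha> * cnj \<alpha> * of_real M = 1"
      using \<alpha>(2) M(2) by (simp add: complex_norm_square[symmetric] power_divide flip: of_real_mult)
    moreover have "\<beta> * cnj \<beta> = 1"
      using \<beta>(2) by (simp add: complex_norm_square[symmetric])
    ultimately have "hform a b (\<gamma> t) (\<gamma> t) = 1" for t
      unfolding \<gamma>_def hform_simps M N orth orth' by (simp add: mult_ac)
    then have FF: "hform A B (F (\<gamma> t)) (F (\<gamma> t)) = 1" if "t \<in> ball 0 \<rho>" for t
      using FQ \<gamma>W that by blast
    have hol: "(\<lambda>t. F (\<gamma> t) k) holomorphic_on ball 0 \<rho>" if "k < A + B" for k
      unfolding \<gamma>_def
      by (rule holomorphic_fun_line[OF F[OF that] W]) (use \<gamma>W in \<open>auto simp: \<gamma>_def\<close>)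
    have "hform A B (F (\<gamma> t)) (F (\<gamma> s)) = 1" if "t \<in> ball 0 (\<rho> / 2)" "s \<in> ball 0 (\<rho> / 2)" for t s
      unfolding hform_def
      by (rule hermitian_polarization[OF hol _ that]) (use FF in \<open>auto simp: hform_def\<close>)
    then show ?thesis
      unfolding \<Delta>_def \<gamma>_def[symmetric] using ts by (intro minor_affine_form_isotropic) blast
  qed
  have hol\<alpha>: "(\<lambda>\<alpha>. \<Delta> \<alpha> \<beta>) holomorphic_on ball 1 \<rho>'" if "\<beta> \<in> ball 0 2" for \<beta>
    unfolding \<Delta>_def affine_form_def
  proof (intro holomorphic_on_minor holomorphic_intros)
    fix j k assume "k \<in> {..<A + B}"
    then have "(\<lambda>\<alpha>. F (\<lambda>l. ts j * (w l + \<beta> * u l) + \<alpha> * q l) k) holomorphic_on ball 1 \<rho>'"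
      using mem[OF _ that ts'[of j]]
      by (intro holomorphic_fun_line[OF F W]) (auto simp: add.commute)
    then show "(\<lambda>\<alpha>. F (\<lambda>l. \<alpha> * q l + ts j * (w l + \<beta> * u l)) k) holomorphic_on ball 1 \<rho>'"
      by (simp add: add.commute)
  qed
  have "\<rho>' > 0"
    using \<rho>' by (rule le_less_trans[OF abs_ge_zero])
  \<comment> \<open>The ball about 1 contains the real point \<open>1 / sqrt M\<close>, hence an arc
    of the circle on which \<open>\<Delta>\<close> vanishes.\<close>
  have step1: "\<Delta> 1 \<beta> = 0" if "\<beta> \<in> ball 0 2" "cmod \<beta> = 1" for \<beta>
  proof (rule holomorphic_zero_on_circle[OF hol\<alpha>[OF that(1)], where c = "1 / sqrt M"])
    have "complex_of_real (1 / sqrt M) - 1 = of_real (1 / sqrt M - 1)"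
      by simp
    then have "dist (complex_of_real (1 / sqrt M)) 1 = \<bar>1 / sqrt M - 1\<bar>"
      unfolding dist_norm by (simp only: norm_of_real)
    then show "complex_of_real (1 / sqrt M) \<in> ball 1 \<rho>'"
      unfolding mem_ball dist_commute[of 1] using \<rho>' by (simp only:)
  qed (use on_quadric that M(2) \<open>\<rho>' > 0\<close> in auto)
  \<comment> \<open>The disc of radius 2 contains both the unit circle, where
    \<open>\<Delta> 1\<close> is known to vanish, and its centre 0.\<close>
  have "(\<lambda>\<beta>. \<Delta> 1 \<beta>) holomorphic_on ball 0 2"
    unfolding \<Delta>_def affine_form_def
  proof (intro holomorphic_on_minor holomorphic_intros)
    fix j k assume k: "k \<in> {..<A + B}"
    have eq: "(\<lambda>l. 1 * q l + ts j * (w l + \<beta> * u l)) = (\<lambda>l. (q l + ts j * w l) + \<beta> * (ts j * u l))" for \<beta>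
      by (simp add: fun_eq_iff algebra_simps)
    show "(\<lambda>\<beta>. F (\<lambda>l. 1 * q l + ts j * (w l + \<beta> * u l)) k) holomorphic_on ball 0 2"
      unfolding eq
    proof (rule holomorphic_fun_line[OF F W])
      show "(\<lambda>l. (q l + ts j * w l) + \<beta> * (ts j * u l)) \<in> W" if "\<beta> \<in> ball 0 2" for \<beta>
        unfolding eq[symmetric] using \<open>\<rho>' > 0\<close> that ts' by (intro mem) auto
    qed (use k in auto)
  qed
  then have "\<Delta> 1 0 = 0"
    by (rule holomorphic_zero_on_circle[where c = 1]) (use step1 in auto)
  then show ?thesis
    by (simp add: \<Delta>_def)
qed

section \<open>Lines near a point of the hyperquadric\<close>

lemma cspaceI: "(\<And>j. j \<ge> n \<Longrightarrow> z j = 0) \<Longrightarrow> z \<in> cspace n"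
  by (simp add: cspace_def)

text \<open>Any norm on \<open>cspace n\<close> gives the same neighbourhoods; this one reduces the
  estimates to the triangle inequality in each coordinate.\<close>

definition l1norm :: "nat \<Rightarrow> (nat \<Rightarrow> complex) \<Rightarrow> real" where
  "l1norm n z = (\<Sum>j<n. cmod (z j))"

lemma l1norm_nonneg [simp]: "0 \<le> l1norm n z"
  by (simp add: l1norm_def sum_nonneg)

lemma l1norm_triangle: "l1norm n (\<lambda>j. x j + y j) \<le> l1norm n x + l1norm n y"
  unfolding l1norm_def sum.distrib[symmetric] by (intro sum_mono norm_triangle_ineq)

lemma l1norm_triangle_diff: "l1norm n (\<lambda>j. x j - y j) \<le> l1norm n x + l1norm n y"
  unfolding l1norm_def sum.distrib[symmetric] by (intro sum_mono norm_triangle_ineq4)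

lemma l1norm_scale: "l1norm n (\<lambda>j. c * x j) = cmod c * l1norm n x"
  unfolding l1norm_def sum_distrib_left by (simp add: norm_mult)

lemma l1norm_triangle_via: "l1norm n (\<lambda>j. x j - z j) \<le> l1norm n (\<lambda>j. x j - y j) + l1norm n (\<lambda>j. y j - z j)"
  using l1norm_triangle[of n "\<lambda>j. x j - y j" "\<lambda>j. y j - z j"] by simp

lemma cmod_le_l1norm: "j < n \<Longrightarrow> cmod (z j) \<le> l1norm n z"
  unfolding l1norm_def by (rule member_le_sum[of j _ "\<lambda>j. cmod (z j)"]) auto

lemma hform_bound: "cmod (hform a b x y) \<le> l1norm (a + b) x * l1norm (a + b) y"
proof -
  have "cmod (hform a b x y) \<le> (\<Sum>j<a + b. cmod (x j) * cmod (y j))"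
    unfolding hform_def by (rule sum_norm_le) (simp add: norm_mult)
  also have "\<dots> \<le> (\<Sum>j<a + b. cmod (x j) * l1norm (a + b) y)"
    by (intro sum_mono mult_left_mono cmod_le_l1norm) auto
  also have "\<dots> = l1norm (a + b) x * l1norm (a + b) y"
    by (simp add: l1norm_def sum_distrib_right)
  finally show ?thesis .
qed

lemma hform_diag_real: "hform a b x x = of_real (Re (hform a b x x))"
  unfolding hform_diag by simp

text \<open>Gram-Schmidt applied to a negative basis vector. Removing its components along
  \<open>q\<close> and \<open>w\<close>, which have positive squares, only makes its own square more
  negative, so rescaling that square to \<open>- N\<close> multiplies by at most 2. The explicit
  bound lets one neighbourhood serve all \<open>q\<close> and \<open>w\<close>.\<close>

lemma orthogonal_negative_vector:
  assumes b: "b \<ge> 1" and q: "q \<in> cspace (a + b)" and w: "w \<in> cspace (a + b)"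
    and qw: "hform a b q w = 0"
    and M: "hform a b q q = of_real M" "M \<ge> 1 / 2"
    and N: "hform a b w w = of_real N" "N \<ge> 1 / 2" "N \<le> 3 / 2"
    and K: "l1norm (a + b) q \<le> K" "l1norm (a + b) w \<le> K" "K \<ge> 1"
  shows "\<exists>u\<in>cspace (a + b). hform a b q u = 0 \<and> hform a b w u = 0 \<and>
    hform a b u u = - of_real N \<and> l1norm (a + b) u \<le> 10 * K\<^sup>2"
proof -
  \<comment> \<open>Index \<open>a\<close> is the first negative coordinate; it exists because
    \<open>b \<ge> 1\<close>.\<close>
  define e :: "nat \<Rightarrow> complex" where "e j = (if j = a then 1 else 0)" for j
  have e_norm: "l1norm (a + b) e = 1"
  proof -
    have "l1norm (a + b) e = (\<Sum>j<a + b. if j = a then 1 else 0)"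
      unfolding l1norm_def e_def by (intro sum.cong) auto
    then show ?thesis using b by simp
  qed
  have e_form: "hform a b e e = - 1"
  proof -
    have "hform a b e e = (\<Sum>j<a + b. if j = a then - 1 else 0)"
      unfolding hform_def e_def by (intro sum.cong) auto
    then show ?thesis using b by simp
  qed
  define s t where "s = hform a b e w / of_real N" and "t = hform a b e q / of_real M"
  have wq: "hform a b w q = 0"
    using qw hform_cnj[of a b q w] by simp
  define u' where "u' j = (e j - s * w j) - t * q j" for j
  have u'w: "hform a b u' w = 0"
    unfolding u'_def hform_simps N qw s_def using N(2) by simp
  have u'q: "hform a b u' q = 0"
    unfolding u'_def hform_simps M wq t_def using M(2) by simp
  define \<kappa> where "\<kappa> = 1 + (cmod (hform a b e w))\<^sup>2 / N + (cmod (hform a b e q))\<^sup>2 / M"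
  have \<kappa>: "\<kappa> \<ge> 1"
    unfolding \<kappa>_def using M N by simp
  have u'u': "hform a b u' u' = - of_real \<kappa>"
  proof -
    have "hform a b u' u' = hform a b u' e - cnj s * hform a b u' w - cnj t * hform a b u' q"
      by (subst (2) u'_def[abs_def]) (simp only: hform_diff_right hform_scale_right)
    also have "\<dots> = hform a b u' e"
      using u'w u'q by simp
    also have "\<dots> = hform a b e e - s * hform a b w e - t * hform a b q e"
      unfolding u'_def[abs_def] by (simp only: hform_diff_left hform_scale_left)
    also have "\<dots> = - of_real \<kappa>"
      unfolding e_form s_def t_def \<kappa>_def hform_cnj[of a b e w, symmetric] hform_cnj[of a b e q, symmetric]
      by (simp add: complex_norm_square[symmetric] algebra_simps)
    finally show ?thesis .
  qed
  define r where "r = sqrt (N / \<kappa>)"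
  have r: "0 \<le> r" "r \<le> 2" "r\<^sup>2 * \<kappa> = N"
  proof -
    show "0 \<le> r"
      using \<kappa> N by (simp add: r_def)
    show "r\<^sup>2 * \<kappa> = N"
      using \<kappa> N by (simp add: r_def)
    have "N / \<kappa> \<le> N / 1"
      using \<kappa> N by (intro divide_left_mono) auto
    then have "N / \<kappa> \<le> 2\<^sup>2"
      using N by simp
    then show "r \<le> 2"
      unfolding r_def by (rule real_le_lsqrt[rotated]) auto
  qed
  define u where "u j = of_real r * u' j" for j
  have "u \<in> cspace (a + b)"
    using q w b by (auto simp: cspace_def u_def u'_def e_def)
  moreover have "hform a b q u = 0" "hform a b w u = 0"
    using u'q u'w hform_cnj[of a b u' q] hform_cnj[of a b u' w]
    unfolding u_def hform_simps by simp_all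
  moreover have "hform a b u u = - of_real N"
    unfolding u_def hform_simps u'u' r(3)[symmetric] by (simp add: power2_eq_square)
  moreover have "l1norm (a + b) u \<le> 10 * K\<^sup>2"
  proof -
    \<comment> \<open>The basis vector contributes 1 and each removed component at most
      \<open>2 * K\<^sup>2\<close>, so \<open>u'\<close> has norm at most
      \<open>5 * K\<^sup>2\<close>.\<close>
    have KK: "K \<le> K\<^sup>2" "1 \<le> K\<^sup>2"
      using K(3) by (simp_all add: self_le_power)
    have "cmod s \<le> 2 * K"
    proof -
      have "cmod s = cmod (hform a b e w) / N"
        using N by (simp add: s_def norm_divide)
      also have "\<dots> \<le> K / (1 / 2)"
        using hform_bound[of a b e w] K N unfolding e_norm by (intro frac_le) auto
      finally show ?thesis by simp
    qed
    moreover have "cmod t \<le> 2 * K"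
    proof -
      have "cmod t = cmod (hform a b e q) / M"
        using M by (simp add: t_def norm_divide)
      also have "\<dots> \<le> K / (1 / 2)"
        using hform_bound[of a b e q] K M unfolding e_norm by (intro frac_le) auto
      finally show ?thesis by simp
    qed
    ultimately have "cmod s * l1norm (a + b) w \<le> 2 * K * K" "cmod t * l1norm (a + b) q \<le> 2 * K * K"
      using K by (intro mult_mono; simp)+
    moreover have "l1norm (a + b) u' \<le> 1 + cmod s * l1norm (a + b) w + cmod t * l1norm (a + b) q"
      unfolding u'_def
      using l1norm_triangle_diff[of "a + b" "\<lambda>j. e j - s * w j" "\<lambda>j. t * q j"]
        l1norm_triangle_diff[of "a + b" e "\<lambda>j. s * w j"]
      unfolding l1norm_scale e_norm by linarith
    ultimately have "l1norm (a + b) u' \<le> 5 * K\<^sup>2"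
      using KK unfolding power2_eq_square by linarith
    then have "r * l1norm (a + b) u' \<le> 2 * (5 * K\<^sup>2)"
      using r by (intro mult_mono) auto
    then show ?thesis
      unfolding u_def l1norm_scale using r by simp
  qed
  ultimately show ?thesis
    by blast
qed

text \<open>For \<open>a \<ge> 2\<close> the first two coordinates are positive. In their plane
  \<open>(cnj (z 1), - cnj (z 0))\<close> is orthogonal to \<open>z\<close>; if both entries are
  zero, a basis vector of the plane will do.\<close>

lemma orthogonal_positive_vector:
  assumes a: "a \<ge> 2"
  shows "\<exists>v\<in>cspace (a + b). hform a b z v = 0 \<and> hform a b v v = 1"
proof -
  have two: "hform a b x v = x 0 * cnj (v 0) + x 1 * cnj (v 1)" if "\<And>j. j \<ge> 2 \<Longrightarrow> v j = 0" for x v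
  proof -
    have "hform a b x v = (\<Sum>j<2. (if j < a then 1 else - 1) * x j * cnj (v j))"
      unfolding hform_def by (rule sum.mono_neutral_right) (use a that in auto)
    then show ?thesis
      using a by (simp add: numeral_2_eq_2)
  qed
  define v :: "nat \<Rightarrow> complex" where "v j = (if z 0 = 0 \<and> z 1 = 0 then (if j = 0 then 1 else 0)
    else (if j = 0 then cnj (z 1) else if j = 1 then - cnj (z 0) else 0)
      / of_real (sqrt ((cmod (z 0))\<^sup>2 + (cmod (z 1))\<^sup>2)))" for j
  have v: "v j = 0" if "j \<ge> 2" for j
    using that by (auto simp: v_def)
  have two_v: "hform a b x v = x 0 * cnj (v 0) + x 1 * cnj (v 1)" for x
    by (rule two) (rule v)
  have "hform a b z v = 0"
    unfolding two_v by (simp add: v_def)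
  moreover have "hform a b v v = 1"
  proof (cases "z 0 = 0 \<and> z 1 = 0")
    case True
    then show ?thesis
      unfolding two_v by (simp add: v_def)
  next
    case False
    define d where "d = sqrt ((cmod (z 0))\<^sup>2 + (cmod (z 1))\<^sup>2)"
    have "(cmod (z 0))\<^sup>2 + (cmod (z 1))\<^sup>2 > 0"
      using False by (auto simp: add_pos_nonneg add_nonneg_pos)
    then have d: "d > 0" "d\<^sup>2 = (cmod (z 0))\<^sup>2 + (cmod (z 1))\<^sup>2"
      by (simp_all add: d_def)
    have "hform a b v v = of_real ((cmod (v 0))\<^sup>2 + (cmod (v 1))\<^sup>2)"
      unfolding two_v by (simp add: complex_norm_square[symmetric])
    also have "(cmod (v 0))\<^sup>2 + (cmod (v 1))\<^sup>2 = ((cmod (z 1))\<^sup>2 + (cmod (z 0))\<^sup>2) / d\<^sup>2"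
      unfolding v_def d_def[symmetric] using False d(1)
      by (simp add: norm_divide power_divide add_divide_distrib)
    also have "\<dots> = 1"
      unfolding add.commute[of "(cmod (z 1))\<^sup>2"] d(2)[symmetric] using d(1) by simp
    finally show ?thesis by simp
  qed
  moreover have "v \<in> cspace (a + b)"
    using v a by (intro cspaceI) auto
  ultimately show ?thesis
    by blast
qed

text \<open>The base line is \<open>z0 + t v\<close>. A nearby line \<open>z + t w\<close> is
  rewritten with a base point \<open>q\<close> orthogonal to \<open>w\<close>; then \<open>q\<close>
  and \<open>w\<close> have squares close to 1, a third vector \<open>u\<close> of controlled size
  exists, and the continuation over the two circles stays inside \<open>W\<close>.\<close>

lemma nearby_lines_minor:
  assumes b: "b \<ge> 1" and z0: "z0 \<in> cspace (a + b)" "hform a b z0 z0 = 1"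
    and v: "v \<in> cspace (a + b)" "hform a b v v = 1" "hform a b z0 v = 0"
    and W: "W \<subseteq> cspace (a + b)"
    and R: "R > 0" "\<And>x. x \<in> cspace (a + b) \<Longrightarrow> l1norm (a + b) (\<lambda>j. x j - z0 j) < R \<Longrightarrow> x \<in> W"
    and F: "\<And>k. k < A + B \<Longrightarrow> holomorphic_fun (a + b) W (\<lambda>z. F z k)"
    and FQ: "\<And>z. z \<in> W \<Longrightarrow> hform a b z z = 1 \<Longrightarrow> hform A B (F z) (F z) = 1"
  shows "\<exists>\<eta>>0. \<eta> < R \<and> (\<forall>z\<in>cspace (a + b). \<forall>w\<in>cspace (a + b). \<forall>ts c.
    l1norm (a + b) (\<lambda>j. z j - z0 j) \<le> \<eta> \<longrightarrow> l1norm (a + b) (\<lambda>j. w j - v j) \<le> \<eta> \<longrightarrow>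
    (\<forall>j. cmod (ts j) < \<eta>) \<longrightarrow>
    minor (B + 2) (\<lambda>i j. affine_form (A + B) (c i) (F (\<lambda>l. z l + ts j * w l))) = 0)"
proof -
  let ?n = "a + b"
  let ?l = "l1norm (a + b)"
  define K where "K = ?l z0 + ?l v + 1"
  have K1: "K \<ge> 1"
    by (simp add: K_def)
  \<comment> \<open>The errors below are numerical multiples of \<open>\<eta> * K ^ i\<close> with
    \<open>i \<le> 4\<close>; this choice makes each \<open>\<eta> * K ^ i\<close> at most a
    thousandth of 1 and of \<open>R\<close>.\<close>
  define \<eta> where "\<eta> = min 1 R / (1000 * K ^ 4)"
  have K_pow: "K ^ i \<le> K ^ 4" if "i \<le> 4" for i
    using that K1 by (rule power_increasing)
  have \<eta>0: "\<eta> > 0"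
    using K1 R(1) by (simp add: \<eta>_def)
  have \<eta>K4: "\<eta> * K ^ 4 \<le> 1 / 1000" "\<eta> * K ^ 4 \<le> R / 1000"
    using K1 by (simp_all add: \<eta>_def)
  have \<eta>K: "\<eta> * K ^ i \<le> 1 / 1000" "\<eta> * K ^ i \<le> R / 1000" if "i \<le> 4" for i
    using mult_left_mono[OF K_pow[OF that], of \<eta>] \<eta>0 \<eta>K4 by linarith+
  have \<eta>1: "\<eta> \<le> 1 / 1000" "\<eta> < R"
    using \<eta>K[of 0] R(1) by simp_all
  show ?thesis
  proof (intro exI[of _ \<eta>] conjI ballI allI impI)
    fix z w and ts :: "nat \<Rightarrow> complex" and c
    assume z: "z \<in> cspace ?n" and w: "w \<in> cspace ?n"
      and dz: "?l (\<lambda>j. z j - z0 j) \<le> \<eta>" and dw: "?l (\<lambda>j. w j - v j) \<le> \<eta>"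
      and ts: "\<forall>j. cmod (ts j) < \<eta>"
    have lw: "?l w \<le> K"
    proof -
      have "?l w \<le> ?l v + ?l (\<lambda>j. w j - v j)"
        using l1norm_triangle[of ?n v "\<lambda>j. w j - v j"] by simp
      then show ?thesis
        unfolding K_def using dw \<eta>1(1) l1norm_nonneg[of ?n z0] by linarith
    qed
    have lv: "?l v \<le> K" "?l z0 \<le> K"
      by (simp_all add: K_def)
    define N where "N = Re (hform a b w w)"
    have N: "hform a b w w = of_real N"
      unfolding N_def by (rule hform_diag_real)
    have "hform a b w w - 1 = hform a b (\<lambda>j. w j - v j) w + hform a b v (\<lambda>j. w j - v j)"
      using v by (simp add: hform_simps)
    then have "cmod (of_real (N - 1)) \<le> cmod (hform a b (\<lambda>j. w j - v j) w) + cmod (hform a b v (\<lambda>j. w j - v j))"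
      unfolding N by (metis norm_triangle_ineq of_real_1 of_real_diff)
    also have "\<dots> \<le> \<eta> * K + K * \<eta>"
      by (intro add_mono order_trans[OF hform_bound] mult_mono) (use lw lv dw \<eta>0 K1 in auto)
    finally have N1: "\<bar>N - 1\<bar> \<le> 1 / 2"
      using \<eta>K(1)[of 1] unfolding norm_of_real by (simp add: mult.commute)
    \<comment> \<open>Orthogonal projection onto \<open>w\<close>: shifting the line parameter by
      \<open>s\<close> moves the base point to \<open>q\<close>, orthogonal to
      \<open>w\<close>.\<close>
    define s where "s = hform a b z w / of_real N"
    have "hform a b z w = hform a b (\<lambda>j. z j - z0 j) w + hform a b z0 (\<lambda>j. w j - v j)"
      using v by (simp add: hform_simps)
    then have "cmod (hform a b z w) \<le> cmod (hform a b (\<lambda>j. z j - z0 j) w) + cmod (hform a b z0 (\<lambda>j. w j - v j))"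
      by (metis norm_triangle_ineq)
    also have "\<dots> \<le> \<eta> * K + K * \<eta>"
      by (intro add_mono order_trans[OF hform_bound] mult_mono) (use lw lv dw dz \<eta>0 K1 in auto)
    finally have "cmod (hform a b z w) \<le> 2 * \<eta> * K"
      by (simp add: mult.commute)
    moreover have "N \<ge> 1 / 2"
      using N1 by linarith
    ultimately have "cmod (hform a b z w) / N \<le> 2 * \<eta> * K / (1 / 2)"
      using \<eta>0 K1 by (intro frac_le) auto
    then have s: "cmod s \<le> 4 * \<eta> * K"
      using \<open>N \<ge> 1 / 2\<close> by (simp add: s_def norm_divide)
    define q where "q j = z j - s * w j" for j
    have q: "q \<in> cspace ?n"
      using z w by (auto simp: cspace_def q_def)
    have qw: "hform a b q w = 0"
      unfolding q_def hform_simps N s_def using \<open>N \<ge> 1 / 2\<close> by simp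
    have "?l (\<lambda>j. q j - z0 j) \<le> ?l (\<lambda>j. z j - z0 j) + cmod s * ?l w"
      using l1norm_triangle_diff[of ?n "\<lambda>j. z j - z0 j" "\<lambda>j. s * w j"]
      unfolding l1norm_scale q_def by (simp add: algebra_simps)
    also have "\<dots> \<le> \<eta> + 4 * \<eta> * K * K"
      by (intro add_mono mult_mono) (use dz s lw \<eta>0 K1 in auto)
    also have "\<dots> \<le> 5 * \<eta> * K\<^sup>2"
      using \<eta>0 mult_left_mono[OF one_le_power[OF K1, of 2], of \<eta>] by (simp add: power2_eq_square)
    finally have dq: "?l (\<lambda>j. q j - z0 j) \<le> 5 * \<eta> * K\<^sup>2" .
    have dq1: "?l (\<lambda>j. q j - z0 j) \<le> 1" "?l (\<lambda>j. q j - z0 j) \<le> R / 4"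
      using dq \<eta>K[of 2] R(1) by linarith+
    have lq: "?l q \<le> K"
    proof -
      have "?l q \<le> ?l z0 + ?l (\<lambda>j. q j - z0 j)"
        using l1norm_triangle[of ?n z0 "\<lambda>j. q j - z0 j"] by simp
      then show ?thesis
        unfolding K_def using dq1(1) l1norm_nonneg[of ?n v] by linarith
    qed
    define M where "M = Re (hform a b q q)"
    have M: "hform a b q q = of_real M"
      unfolding M_def by (rule hform_diag_real)
    have "hform a b q q - 1 = hform a b (\<lambda>j. q j - z0 j) q + hform a b z0 (\<lambda>j. q j - z0 j)"
      using z0 by (simp add: hform_simps)
    then have "cmod (of_real (M - 1)) \<le> cmod (hform a b (\<lambda>j. q j - z0 j) q) + cmod (hform a b z0 (\<lambda>j. q j - z0 j))"
      unfolding M by (metis norm_triangle_ineq of_real_1 of_real_diff)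
    also have "\<dots> \<le> (5 * \<eta> * K\<^sup>2) * K + K * (5 * \<eta> * K\<^sup>2)"
      by (intro add_mono order_trans[OF hform_bound] mult_mono) (use lq lv dq \<eta>0 K1 in auto)
    also have "\<dots> = 10 * (\<eta> * K ^ 3)"
      by (simp add: power2_eq_square power3_eq_cube)
    finally have M1: "\<bar>M - 1\<bar> \<le> 10 * (\<eta> * K ^ 3)"
      unfolding norm_of_real .
    then have M2: "\<bar>M - 1\<bar> \<le> 1 / 2"
      using \<eta>K(1)[of 3] by linarith
    then have Mpos: "M \<ge> 1 / 2" "M > 0"
      by linarith+
    \<comment> \<open>The circle for \<open>\<alpha>\<close> has radius \<open>1 / sqrt M\<close>.
      It must come within \<open>R / (4 * K)\<close> of 1 for the continuation to stay in
      \<open>W\<close>.\<close>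
    have "\<bar>1 / sqrt M - 1\<bar> \<le> 2 * \<bar>M - 1\<bar>"
    proof -
      have sq: "sqrt M > 0" "sqrt M * sqrt M = M"
        using Mpos by simp_all
      have "sqrt M \<ge> 1 / 2"
        by (rule real_le_rsqrt) (use Mpos in \<open>simp add: power2_eq_square\<close>)
      have "\<bar>1 / sqrt M - 1\<bar> = \<bar>1 - sqrt M\<bar> / sqrt M"
        using sq(1) by (simp add: field_simps abs_divide[symmetric])
      also have "\<dots> \<le> \<bar>1 - sqrt M\<bar> / (1 / 2)"
        using \<open>sqrt M \<ge> 1 / 2\<close> by (intro frac_le) simp_all
      also have "\<dots> \<le> 2 * \<bar>M - 1\<bar>"
      proof -
        have "M - 1 = (sqrt M - 1) * (sqrt M + 1)"
          using sq(2) by (simp add: algebra_simps)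
        then have "\<bar>M - 1\<bar> = \<bar>sqrt M - 1\<bar> * (sqrt M + 1)"
          using sq(1) by (simp add: abs_mult)
        then show ?thesis
          using sq(1) mult_left_mono[of 1 "sqrt M + 1" "\<bar>sqrt M - 1\<bar>"] by (simp add: abs_minus_commute mult.commute)
      qed
      finally show ?thesis .
    qed
    also have "\<dots> \<le> 20 * (\<eta> * K ^ 3)"
      using M1 by simp
    also have "\<dots> < R / (4 * K)"
    proof -
      have "20 * (\<eta> * K ^ 3) * (4 * K) = 80 * (\<eta> * K ^ 4)"
        by (simp add: power_numeral_reduce)
      also have "\<dots> < R"
        using \<eta>K4 R(1) by linarith
      finally show ?thesis
        using K1 by (simp add: pos_less_divide_eq)
    qed
    finally have \<rho>': "\<bar>1 / sqrt M - 1\<bar> < R / (4 * K)" .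
    have "\<exists>u\<in>cspace ?n. hform a b q u = 0 \<and> hform a b w u = 0 \<and>
        hform a b u u = - of_real N \<and> ?l u \<le> 10 * K\<^sup>2"
      by (rule orthogonal_negative_vector[OF b q w qw M Mpos(1) N \<open>N \<ge> 1 / 2\<close> _ lq lw K1])
        (use N1 in linarith)
    then obtain u where u: "u \<in> cspace ?n" "hform a b q u = 0" "hform a b w u = 0"
        "hform a b u u = - of_real N" "?l u \<le> 10 * K\<^sup>2"
      by blast
    \<comment> \<open>Three contributions of at most \<open>R / 4\<close> are planned: the change of
      \<open>\<alpha>\<close>, the distance from \<open>q\<close> to \<open>z0\<close>, and the
      motion along the line. The direction has norm at most
      \<open>K + 2 * 10 * K\<^sup>2 \<le> 21 * K\<^sup>2\<close>, whence
      \<open>84 = 4 * 21\<close>.\<close>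
    define \<rho> where "\<rho> = R / (84 * K\<^sup>2)"
    have mem: "(\<lambda>j. \<alpha> * q j + t * (w j + \<beta> * u j)) \<in> W"
      if \<alpha>: "\<alpha> \<in> ball 1 (R / (4 * K))" and \<beta>: "\<beta> \<in> ball 0 2" and t: "t \<in> ball 0 \<rho>" for \<alpha> \<beta> t
    proof (rule R(2))
      show "(\<lambda>j. \<alpha> * q j + t * (w j + \<beta> * u j)) \<in> cspace ?n"
        using q w u(1) by (auto simp: cspace_def)
      have "(\<lambda>j. \<alpha> * q j + t * (w j + \<beta> * u j) - z0 j)
          = (\<lambda>j. ((\<alpha> - 1) * q j + (q j - z0 j)) + t * (w j + \<beta> * u j))"
        by (simp add: fun_eq_iff algebra_simps)
      then have "?l (\<lambda>j. \<alpha> * q j + t * (w j + \<beta> * u j) - z0 j)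
          \<le> cmod (\<alpha> - 1) * ?l q + ?l (\<lambda>j. q j - z0 j) + cmod t * (?l w + cmod \<beta> * ?l u)"
        using l1norm_triangle[of ?n "\<lambda>j. (\<alpha> - 1) * q j + (q j - z0 j)" "\<lambda>j. t * (w j + \<beta> * u j)"]
          l1norm_triangle[of ?n "\<lambda>j. (\<alpha> - 1) * q j" "\<lambda>j. q j - z0 j"]
          mult_left_mono[OF l1norm_triangle[of ?n w "\<lambda>j. \<beta> * u j"], of "cmod t"]
        unfolding l1norm_scale by simp
      also have "\<dots> \<le> R / (4 * K) * K + R / 4 + \<rho> * (K + 2 * (10 * K\<^sup>2))"
      proof (intro add_mono mult_mono dq1)
        show "cmod (\<alpha> - 1) \<le> R / (4 * K)"
          using \<alpha> by (simp add: dist_norm norm_minus_commute)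
      qed (use \<beta> t lq lw u(5) K1 R(1) in \<open>auto simp: \<rho>_def\<close>)
      also have "\<dots> \<le> R / (4 * K) * K + R / 4 + \<rho> * (21 * K\<^sup>2)"
        using K1 R(1) by (intro add_mono mult_left_mono) (auto simp: power2_eq_square \<rho>_def)
      also have "\<dots> = 3 / 4 * R"
        using K1 by (simp add: \<rho>_def field_simps)
      also have "\<dots> < R"
        using R(1) by simp
      finally show "?l (\<lambda>j. \<alpha> * q j + t * (w j + \<beta> * u j) - z0 j) < R" .
    qed
    \<comment> \<open>The nodes shift by \<open>s\<close> together with the base point, and
      polarization needs them in the disc of half radius.\<close>
    have ts': "ts j + s \<in> ball 0 (\<rho> / 2)" for j
    proof -
      have "cmod (ts j + s) < \<eta> + 4 * \<eta> * K"
        using norm_triangle_ineq[of "ts j" s] s ts[rule_format, of j] by linarith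
      also have "\<dots> \<le> 5 * (\<eta> * K)"
        using K1 \<eta>0 by (simp add: algebra_simps)
      also have "\<dots> \<le> \<rho> / 2"
      proof -
        have "5 * (\<eta> * K) * (168 * K\<^sup>2) = 840 * (\<eta> * K ^ 3)"
          by (simp add: power_numeral_reduce)
        also have "\<dots> \<le> R"
          using \<eta>K(2)[of 3] R(1) by linarith
        finally have "5 * (\<eta> * K) \<le> R / (168 * K\<^sup>2)"
          using K1 by (subst pos_le_divide_eq) auto
        then show ?thesis
          by (simp add: \<rho>_def)
      qed
      finally show ?thesis
        by simp
    qed
    have "minor (B + 2) (\<lambda>i j. affine_form (A + B) (c i) (F (\<lambda>l. q l + (ts j + s) * w l))) = 0"
      by (rule minor_on_complexified_line[OF W q w u(1) F FQ qw u(2,3) M Mpos(2) N u(4) \<rho>' mem ts'])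
    moreover have "(\<lambda>l. q l + (ts j + s) * w l) = (\<lambda>l. z l + ts j * w l)" for j
      by (simp add: q_def fun_eq_iff algebra_simps)
    ultimately show "minor (B + 2) (\<lambda>i j. affine_form (A + B) (c i) (F (\<lambda>l. z l + ts j * w l))) = 0"
      by (simp only:)
  qed (use \<eta>0 \<eta>1 in auto)
qed

section \<open>Propagation of affine relations\<close>

lemma holomorphic_fun_subset:
  "holomorphic_fun n W g \<Longrightarrow> W' \<subseteq> W \<Longrightarrow> holomorphic_fun n W' g"
  unfolding holomorphic_fun_def by (blast intro: tendsto_within_subset)

text \<open>A basic open set of the product topology is a box. Coordinates from \<open>n\<close> on
  agree with those of \<open>p\<close>, so only finitely many sides limit the radius.\<close>

lemma open_contains_l1ball:
  fixes p :: "nat \<Rightarrow> complex"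
  assumes "open V" "p \<in> V" "p \<in> cspace n"
  shows "\<exists>R>0. \<forall>z\<in>cspace n. l1norm n (\<lambda>j. z j - p j) < R \<longrightarrow> z \<in> V"
proof -
  have "openin (product_topology (\<lambda>i. euclidean) UNIV) V"
    using assms(1) by (simp add: open_fun_def)
  from product_topology_open_contains_basis[OF this assms(2)]
  obtain X where X: "p \<in> (\<Pi>\<^sub>E i\<in>UNIV. X i)" "\<And>i. open (X i)" "(\<Pi>\<^sub>E i\<in>UNIV. X i) \<subseteq> V"
    by auto
  have "\<forall>i. \<exists>e>0. ball (p i) e \<subseteq> X i"
    using X(1,2) by (auto simp: open_contains_ball)
  then obtain e where e: "\<And>i. e i > 0" "\<And>i. ball (p i) (e i) \<subseteq> X i"
    by metis
  \<comment> \<open>Inserting 1 keeps the minimum over a nonempty set when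
    \<open>n = 0\<close>.\<close>
  define R where "R = Min (insert 1 (e ` {..<n}))"
  have R: "R > 0"
    unfolding R_def using e(1) by (subst Min_gr_iff) auto
  have "z \<in> V" if z: "z \<in> cspace n" "l1norm n (\<lambda>j. z j - p j) < R" for z
  proof -
    have "z i \<in> X i" for i
    proof (cases "i < n")
      case True
      have "cmod (z i - p i) \<le> l1norm n (\<lambda>j. z j - p j)"
        using True by (rule cmod_le_l1norm)
      moreover have "R \<le> e i"
        unfolding R_def using True by (intro Min_le) auto
      ultimately have "z i \<in> ball (p i) (e i)"
        using z(2) by (simp add: dist_norm norm_minus_commute)
      then show ?thesis
        using e(2) by blast
    next
      case False
      then have "z i = p i"
        using z(1) assms(3) by (simp add: cspace_def)
      then show ?thesis
        using X(1) by auto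
    qed
    then show ?thesis
      using X(3) by auto
  qed
  with R show ?thesis
    by blast
qed

lemma open_l1ball: "open {x. l1norm n (\<lambda>j. x j - p j) < R}"
  unfolding l1norm_def
  by (intro open_Collect_less continuous_intros continuous_on_product_coordinates)

lemma convex_l1ball_line: "convex {t. l1norm n (\<lambda>j. x j + t * d j) < R}"
proof (rule convexI)
  fix s t :: complex and u v :: real
  assume s: "s \<in> {t. l1norm n (\<lambda>j. x j + t * d j) < R}"
    and t: "t \<in> {t. l1norm n (\<lambda>j. x j + t * d j) < R}" and uv: "0 \<le> u" "0 \<le> v" "u + v = 1"
  have "(\<lambda>j. x j + (u *\<^sub>R s + v *\<^sub>R t) * d j)
      = (\<lambda>j. of_real u * (x j + s * d j) + of_real v * (x j + t * d j))"
  proof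
    fix j
    have "of_real u * x j + of_real v * x j = x j"
      using uv(3) by (metis distrib_right mult_1 of_real_1 of_real_add)
    then show "x j + (u *\<^sub>R s + v *\<^sub>R t) * d j = of_real u * (x j + s * d j) + of_real v * (x j + t * d j)"
      by (simp add: scaleR_conv_of_real algebra_simps)
  qed
  then have "l1norm n (\<lambda>j. x j + (u *\<^sub>R s + v *\<^sub>R t) * d j)
      \<le> u * l1norm n (\<lambda>j. x j + s * d j) + v * l1norm n (\<lambda>j. x j + t * d j)"
    using l1norm_triangle[of n "\<lambda>j. of_real u * (x j + s * d j)" "\<lambda>j. of_real v * (x j + t * d j)"] uv
    unfolding l1norm_scale by simp
  also have "\<dots> < R"
    using s t uv by (intro convex_bound_lt) auto
  finally show "u *\<^sub>R s + v *\<^sub>R t \<in> {t. l1norm n (\<lambda>j. x j + t * d j) < R}"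
    by simp
qed

text \<open>The complex line through \<open>x\<close> and \<open>y\<close> meets the ball in a
  convex set of parameters, and \<open>g\<close> vanishes on it near \<open>x\<close>; the identity
  theorem carries this to \<open>y\<close>.\<close>

lemma vanishing_propagates_in_l1ball:
  assumes g: "\<And>x y T. open T \<Longrightarrow> (\<And>t. t \<in> T \<Longrightarrow> (\<lambda>j. x j + t * y j) \<in> W) \<Longrightarrow>
      (\<lambda>t. g (\<lambda>j. x j + t * y j)) holomorphic_on T"
    and W: "\<And>y. y \<in> cspace n \<Longrightarrow> l1norm n (\<lambda>j. y j - z j) < R \<Longrightarrow> y \<in> W"
    and x: "x \<in> cspace n" "l1norm n (\<lambda>j. x j - z j) < R"
    and zero: "R' > 0" "\<And>y. y \<in> cspace n \<Longrightarrow> l1norm n (\<lambda>j. y j - x j) < R' \<Longrightarrow> g y = 0"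
    and y: "y \<in> cspace n" "l1norm n (\<lambda>j. y j - z j) < R"
  shows "g y = 0"
proof -
  define d where "d j = y j - x j" for j
  define T where "T = {t. l1norm n (\<lambda>j. (x j - z j) + t * d j) < R}"
  define T' where "T' = {t. l1norm n (\<lambda>j. 0 + t * d j) < R'}"
  have T: "open T" "connected T"
  proof -
    show "open T"
      unfolding T_def l1norm_def by (intro open_Collect_less continuous_intros)
    show "connected T"
      unfolding T_def by (intro convex_connected convex_l1ball_line)
  qed
  have "open T'"
    unfolding T'_def l1norm_def by (intro open_Collect_less continuous_intros)
  have cs: "(\<lambda>j. x j + t * d j) \<in> cspace n" for t
    using x y by (auto simp: cspace_def d_def)
  have "(\<lambda>t. g (\<lambda>j. x j + t * d j)) holomorphic_on T"
  proof (rule g[OF T(1)])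
    show "(\<lambda>j. x j + t * d j) \<in> W" if "t \<in> T" for t
      by (rule W[OF cs]) (use that in \<open>simp add: T_def algebra_simps\<close>)
  qed
  moreover have "0 islimpt T \<inter> T'"
  proof (rule interior_limit_point)
    have "0 \<in> T \<inter> T'"
      using x zero(1) by (simp add: T_def T'_def l1norm_def)
    then show "0 \<in> interior (T \<inter> T')"
      using T(1) \<open>open T'\<close> by (simp only: interior_open open_Int)
  qed
  moreover have "g (\<lambda>j. x j + t * d j) = 0" if "t \<in> T \<inter> T'" for t
    by (rule zero(2)[OF cs]) (use that in \<open>simp add: T'_def\<close>)
  moreover have "0 \<in> T" "1 \<in> T"
    using x y by (simp_all add: T_def d_def)
  ultimately have "g (\<lambda>j. x j + 1 * d j) = 0"
    using analytic_continuation[of "\<lambda>t. g (\<lambda>j. x j + t * d j)" T "T \<inter> T'" 0 1] T by simp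
  then show ?thesis
    by (simp add: d_def)
qed

text \<open>\<open>U\<close> may be thin in \<open>cspace n\<close>, so \<open>Z\<close> records
  vanishing on a full neighbourhood in \<open>cspace n\<close>. \<open>Z\<close> is closed in
  \<open>U\<close> because one point of \<open>Z\<close> in a ball about \<open>z\<close> forces
  vanishing on the whole ball.\<close>

lemma vanishing_on_connected:
  assumes g: "\<And>x y T. open T \<Longrightarrow> (\<And>t. t \<in> T \<Longrightarrow> (\<lambda>j. x j + t * y j) \<in> W) \<Longrightarrow>
      (\<lambda>t. g (\<lambda>j. x j + t * y j)) holomorphic_on T"
    and W: "\<And>z. z \<in> U \<Longrightarrow> \<exists>R>0. \<forall>y\<in>cspace n. l1norm n (\<lambda>j. y j - z j) < R \<longrightarrow> y \<in> W"
    and U: "connected U" "U \<subseteq> cspace n"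
    and p: "p \<in> U" "R0 > 0" "\<And>y. y \<in> cspace n \<Longrightarrow> l1norm n (\<lambda>j. y j - p j) < R0 \<Longrightarrow> g y = 0"
    and x: "x \<in> U"
  shows "g x = 0"
proof -
  define Z where "Z = {z \<in> U. \<exists>R>0. \<forall>y\<in>cspace n. l1norm n (\<lambda>j. y j - z j) < R \<longrightarrow> g y = 0}"
  have ball_open: "openin (top_of_set U) (U \<inter> {x. l1norm n (\<lambda>j. x j - z j) < R})" for z R
    by (intro openin_open_Int open_l1ball)
  have self: "l1norm n (\<lambda>j. z j - z j) = 0" for z
    by (simp add: l1norm_def)
  have "openin (top_of_set U) Z"
  proof (subst openin_subopen, intro ballI)
    fix z assume "z \<in> Z"
    then obtain R where R: "z \<in> U" "R > 0"
      "\<And>y. y \<in> cspace n \<Longrightarrow> l1norm n (\<lambda>j. y j - z j) < R \<Longrightarrow> g y = 0"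
      unfolding Z_def by blast
    have "U \<inter> {x. l1norm n (\<lambda>j. x j - z j) < R / 2} \<subseteq> Z"
    proof
      fix x assume x: "x \<in> U \<inter> {x. l1norm n (\<lambda>j. x j - z j) < R / 2}"
      have "g y = 0" if "y \<in> cspace n" "l1norm n (\<lambda>j. y j - x j) < R / 2" for y
      proof (rule R(3)[OF that(1)])
        show "l1norm n (\<lambda>j. y j - z j) < R"
          using l1norm_triangle_via[of n y z x] that(2) x by simp
      qed
      then show "x \<in> Z"
        using x R(2) unfolding Z_def by (blast intro: half_gt_zero)
    qed
    moreover have "z \<in> U \<inter> {x. l1norm n (\<lambda>j. x j - z j) < R / 2}"
      using R self by simp
    ultimately show "\<exists>T. openin (top_of_set U) T \<and> z \<in> T \<and> T \<subseteq> Z"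
      using ball_open by blast
  qed
  moreover have "openin (top_of_set U) (U - Z)"
  proof (subst openin_subopen, intro ballI)
    fix z assume z: "z \<in> U - Z"
    then obtain R where R: "R > 0" "\<And>y. y \<in> cspace n \<Longrightarrow> l1norm n (\<lambda>j. y j - z j) < R \<Longrightarrow> y \<in> W"
      using W by blast
    have "U \<inter> {x. l1norm n (\<lambda>j. x j - z j) < R} \<subseteq> U - Z"
    proof
      fix x assume x: "x \<in> U \<inter> {x. l1norm n (\<lambda>j. x j - z j) < R}"
      have "x \<notin> Z"
      proof
        assume "x \<in> Z"
        then obtain R' where R': "R' > 0" "\<And>y. y \<in> cspace n \<Longrightarrow> l1norm n (\<lambda>j. y j - x j) < R' \<Longrightarrow> g y = 0"
          unfolding Z_def by blast
        have xc: "x \<in> cspace n" "l1norm n (\<lambda>j. x j - z j) < R"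
          using x U(2) by auto
        have "g y = 0" if y: "y \<in> cspace n" "l1norm n (\<lambda>j. y j - z j) < R" for y
          by (rule vanishing_propagates_in_l1ball[OF g R(2) xc R' y])
        then have "z \<in> Z"
          using z R(1) unfolding Z_def by blast
        with z show False by blast
      qed
      then show "x \<in> U - Z"
        using x by blast
    qed
    moreover have "z \<in> U \<inter> {x. l1norm n (\<lambda>j. x j - z j) < R}"
      using z R self by simp
    ultimately show "\<exists>T. openin (top_of_set U) T \<and> z \<in> T \<and> T \<subseteq> U - Z"
      using ball_open by blast
  qed
  then have "closedin (top_of_set U) Z"
    unfolding closedin_def by (auto simp: Z_def)
  moreover have "p \<in> Z"
    using p unfolding Z_def by blast
  ultimately have "Z = U"
    using U(1) unfolding connected_clopen by blast
  then obtain R where "R > 0" "\<And>y. y \<in> cspace n \<Longrightarrow> l1norm n (\<lambda>j. y j - x j) < R \<Longrightarrow> g y = 0"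
    using x unfolding Z_def by blast
  moreover have "x \<in> cspace n"
    using x U(2) by blast
  ultimately show ?thesis
    by (metis self)
qed

section \<open>Affine forms and complex hyperplanes\<close>

lemma sum_fun_apply: "(\<Sum>i\<in>I. h i :: nat \<Rightarrow> complex) k = (\<Sum>i\<in>I. h i k)"
  by (induction I rule: infinite_finite_induct) auto

text \<open>The zero set is the kernel \<open>V\<close> of the linear part, translated by
  \<open>p\<close>. Subtracting a multiple of \<open>e k0\<close> moves any vector into
  \<open>V\<close>, so a basis of \<open>V\<close> together with \<open>e k0\<close> is a basis of
  \<open>cspace m\<close>.\<close>

lemma complex_hyperplane_affine_form:
  assumes k0: "k0 < m" "c k0 \<noteq> 0"
  shows "complex_hyperplane m {w \<in> cspace m. affine_form m c w = 0}"
proof -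
  define V where "V = {w \<in> cspace m. (\<Sum>k<m. c k * w k) = 0}"
  define e :: "nat \<Rightarrow> nat \<Rightarrow> complex" where "e i k = (if k = i then 1 else 0)" for i k
  define p where "p = cscale (- c m / c k0) (e k0)"
  have sum_e: "(\<Sum>k<m. c k * (s * e k0 k)) = s * c k0" for s
  proof -
    have "(\<Sum>k<m. c k * (s * e k0 k)) = (\<Sum>k<m. if k = k0 then s * c k0 else 0)"
      by (intro sum.cong) (auto simp: e_def)
    then show ?thesis
      using k0 by simp
  qed
  have e_mem: "cscale s (e i) \<in> cspace m" if "i < m" for s i
    using that by (auto simp: cspace_def cscale_def e_def)
  have p: "p \<in> cspace m" "(\<Sum>k<m. c k * p k) = - c m"
    unfolding p_def by (rule e_mem[OF k0(1)])
      (simp only: cscale_def sum_e, use k0 in simp)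
  have subspace: "cvec.subspace V"
    unfolding cvec.subspace_def
    by (auto simp: V_def cspace_def cscale_def algebra_simps sum.distrib sum_distrib_left[symmetric])
  have translate: "{w \<in> cspace m. affine_form m c w = 0} = (+) p ` V"
  proof (intro subset_antisym subsetI)
    fix w assume "w \<in> {w \<in> cspace m. affine_form m c w = 0}"
    then have "w - p \<in> V"
      using p by (auto simp: V_def affine_form_def cspace_def algebra_simps sum_subtractf)
    then have "p + (w - p) \<in> (+) p ` V"
      by (rule imageI)
    then show "w \<in> (+) p ` V"
      by simp
  next
    fix w assume "w \<in> (+) p ` V"
    then show "w \<in> {w \<in> cspace m. affine_form m c w = 0}"
      using p by (auto simp: V_def affine_form_def cspace_def algebra_simps sum.distrib)
  qed
  obtain Bs where Bs: "Bs \<subseteq> V" "cvec.independent Bs" "V \<subseteq> cvec.span Bs" "card Bs = cvec.dim V"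
    by (rule cvec.basis_exists)
  have span_V: "cvec.span Bs \<subseteq> V"
    using Bs(1) subspace by (rule cvec.span_minimal)
  have "cspace m \<subseteq> cvec.span (e ` {..<m})"
  proof
    fix w assume w: "w \<in> cspace m"
    have "w = (\<Sum>i<m. cscale (w i) (e i))"
    proof
      fix k
      have "(\<Sum>i<m. cscale (w i) (e i)) k = (\<Sum>i<m. if i = k then w k else 0)"
        unfolding sum_fun_apply by (intro sum.cong) (auto simp: cscale_def e_def)
      then show "w k = (\<Sum>i<m. cscale (w i) (e i)) k"
        using w by (auto simp: cspace_def)
    qed
    also have "\<dots> \<in> cvec.span (e ` {..<m})"
      by (intro cvec.span_sum cvec.span_scale cvec.span_base imageI)
    finally show "w \<in> cvec.span (e ` {..<m})" .
  qed
  then have "Bs \<subseteq> cvec.span (e ` {..<m})"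
    using Bs(1) by (auto simp: V_def)
  then have fin: "finite Bs"
    using cvec.independent_span_bound[of "e ` {..<m}" Bs] Bs(2) by simp
  have "e k0 \<notin> V"
    using sum_e[of 1] k0 by (simp add: V_def)
  then have new: "e k0 \<notin> cvec.span Bs" "e k0 \<notin> Bs"
    using span_V Bs(1) by blast+
  have "cspace m \<subseteq> cvec.span (insert (e k0) Bs)"
  proof
    fix w assume w: "w \<in> cspace m"
    define s where "s = (\<Sum>k<m. c k * w k) / c k0"
    have "w - cscale s (e k0) \<in> V"
      using w e_mem[OF k0(1), of s] sum_e[of s] k0
      by (auto simp: V_def cspace_def cscale_def s_def algebra_simps sum_subtractf)
    then have "w - cscale s (e k0) \<in> cvec.span (insert (e k0) Bs)"
      using Bs(3) cvec.span_mono[of Bs "insert (e k0) Bs"] by blast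
    moreover have "cscale s (e k0) \<in> cvec.span (insert (e k0) Bs)"
      by (intro cvec.span_scale cvec.span_base) simp
    ultimately have "(w - cscale s (e k0)) + cscale s (e k0) \<in> cvec.span (insert (e k0) Bs)"
      by (rule cvec.span_add)
    then show "w \<in> cvec.span (insert (e k0) Bs)"
      by simp
  qed
  moreover have "insert (e k0) Bs \<subseteq> cspace m"
    using Bs(1) e_mem[OF k0(1), of 1] by (auto simp: V_def cscale_def)
  moreover have "cvec.independent (insert (e k0) Bs)"
    using new Bs(2) by (intro cvec.independent_insertI)
  moreover have "card (insert (e k0) Bs) = cvec.dim V + 1"
    using fin new Bs(4) by simp
  ultimately have "cvec.dim (cspace m) = cvec.dim V + 1"
    by (intro cvec.dim_unique)
  then show ?thesis
    unfolding complex_hyperplane_def using p(1) subspace translate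
    by (intro exI[of _ p] exI[of _ V]) (auto simp: V_def)
qed

text \<open>Each point imposes one linear equation on the \<open>m + 1\<close> coefficients, which
  leaves fewer equations than unknowns.\<close>

lemma affine_relation_on_finite_set:
  assumes "finite S" "card S < m + 1"
  shows "\<exists>c. (\<exists>k<m + 1. c k \<noteq> 0) \<and> (\<forall>w\<in>S. affine_form m c w = 0)"
proof -
  obtain h where h: "bij_betw h {0..<card S} S"
    using assms(1) ex_bij_betw_nat_finite by blast
  obtain c where c: "\<exists>k<m + 1. c k \<noteq> 0"
    "\<And>i. i < card S \<Longrightarrow> (\<Sum>k<m + 1. (if k < m then h i k else 1) * c k) = 0"
    using underdetermined_system[OF assms(2), of "\<lambda>i k. if k < m then h i k else 1"] by blast
  have "affine_form m c w = 0" if "w \<in> S" for w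
  proof -
    have "w \<in> h ` {0..<card S}"
      using that h by (simp only: bij_betw_def)
    then obtain i where "i < card S" "w = h i"
      by auto
    then show ?thesis
      using c(2)[of i] by (simp add: affine_form_def mult.commute add.commute)
  qed
  with c(1) show ?thesis
    by blast
qed

section \<open>The bound on the target signature\<close>

text \<open>Affine forms make up a space of dimension \<open>A + B + 1\<close>. By
  \<open>nonflat\<close> no nonzero one vanishes on the image of \<open>U\<close>, so evaluation at
  the determining points is injective and their number bounds the dimension.\<close>

lemma real_analytic_CR_map_target_bound:
  assumes ab: "a \<ge> 2" "b \<ge> 1"
    and U: "U \<noteq> {}" "connected U" "openin (top_of_set (hyperquadric a b)) U"
    and f: "real_analytic_CR_map a b A B U f"
    and nonflat: "\<not> (\<exists>H. complex_hyperplane (A + B) H \<and> f ` U \<subseteq> H)"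
  shows "A + B + 1 \<le> (B + 1) ^ (a + b)"
proof (rule ccontr)
  assume large: "\<not> A + B + 1 \<le> (B + 1) ^ (a + b)"
  let ?n = "a + b"
  let ?m = "A + B"
  let ?l = "l1norm ?n"
  obtain W0 F where W0: "openin (top_of_set (cspace ?n)) W0" "U \<subseteq> W0"
    and F: "holomorphic_map ?n ?m W0 F" and Ff: "\<And>z. z \<in> U \<Longrightarrow> F z = f z"
    and fQ: "f ` U \<subseteq> hyperquadric A B"
    using f unfolding real_analytic_CR_map_def by blast
  obtain V where V: "open V" "W0 = cspace ?n \<inter> V"
    using W0(1) unfolding openin_open by blast
  obtain V' where V': "open V'" "U = hyperquadric a b \<inter> V'"
    using U(3) unfolding openin_open by blast
  \<comment> \<open>Intersecting with \<open>V'\<close> puts every point of the hyperquadric in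
    \<open>W\<close> into \<open>U\<close>, where \<open>F\<close> is known to take values in the
    target hyperquadric.\<close>
  define W where "W = cspace ?n \<inter> (V \<inter> V')"
  have W_cspace: "W \<subseteq> cspace ?n"
    by (auto simp: W_def)
  have U_cspace: "U \<subseteq> cspace ?n"
    unfolding V'(2) by (auto simp: hyperquadric_iff)
  have UW: "U \<subseteq> W"
    using W0(2) V(2) V'(2) U_cspace by (auto simp: W_def)
  have hol: "holomorphic_fun ?n W (\<lambda>z. F z k)" if "k < ?m" for k
  proof (rule holomorphic_fun_subset)
    show "holomorphic_fun ?n W0 (\<lambda>z. F z k)"
      using F that unfolding holomorphic_map_def by blast
  qed (auto simp: W_def V(2))
  have FQ: "hform A B (F z) (F z) = 1" if "z \<in> W" "hform a b z z = 1" for z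
  proof -
    have "z \<in> U"
      using that V'(2) by (auto simp: W_def hyperquadric_iff)
    then show ?thesis
      using fQ Ff by (force simp: hyperquadric_iff)
  qed
  have W_ball: "\<exists>R>0. \<forall>y\<in>cspace ?n. ?l (\<lambda>j. y j - z j) < R \<longrightarrow> y \<in> W" if "z \<in> U" for z
  proof -
    have "z \<in> V \<inter> V'" "z \<in> cspace ?n"
      using UW that by (auto simp: W_def)
    from open_contains_l1ball[OF open_Int[OF V(1) V'(1)] this] show ?thesis
      unfolding W_def by blast
  qed
  have g_hol: "(\<lambda>t. affine_form ?m c (F (\<lambda>j. x j + t * y j))) holomorphic_on T"
    if "open T" "\<And>t. t \<in> T \<Longrightarrow> (\<lambda>j. x j + t * y j) \<in> W" for c x y T
    unfolding affine_form_def
    by (intro holomorphic_intros holomorphic_fun_line[OF hol W_cspace that]) auto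
  obtain z0 where z0U: "z0 \<in> U"
    using U(1) by blast
  then have z0: "z0 \<in> cspace ?n" "hform a b z0 z0 = 1"
    unfolding V'(2) by (auto simp: hyperquadric_iff)
  obtain R where R: "R > 0" "\<And>y. y \<in> cspace ?n \<Longrightarrow> ?l (\<lambda>j. y j - z0 j) < R \<Longrightarrow> y \<in> W"
    using W_ball[OF z0U] by blast
  obtain v where v: "v \<in> cspace ?n" "hform a b z0 v = 0" "hform a b v v = 1"
    using orthogonal_positive_vector[OF ab(1)] by blast
  have "\<exists>\<eta>>0. \<eta> < R \<and> (\<forall>z\<in>cspace ?n. \<forall>w\<in>cspace ?n. \<forall>ts c.
      ?l (\<lambda>j. z j - z0 j) \<le> \<eta> \<longrightarrow> ?l (\<lambda>j. w j - v j) \<le> \<eta> \<longrightarrow> (\<forall>j. cmod (ts j) < \<eta>) \<longrightarrow>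
      minor (B + 2) (\<lambda>i j. affine_form ?m (c i) (F (\<lambda>l. z l + ts j * w l))) = 0)"
    by (rule nearby_lines_minor[OF ab(2) z0 v(1,3,2) W_cspace R hol FQ])
  then obtain \<eta> where \<eta>: "\<eta> > 0" "\<eta> < R"
    and lines: "\<forall>z\<in>cspace ?n. \<forall>w\<in>cspace ?n. \<forall>ts c.
      ?l (\<lambda>j. z j - z0 j) \<le> \<eta> \<longrightarrow> ?l (\<lambda>j. w j - v j) \<le> \<eta> \<longrightarrow> (\<forall>j. cmod (ts j) < \<eta>) \<longrightarrow>
      minor (B + 2) (\<lambda>i j. affine_form ?m (c i) (F (\<lambda>l. z l + ts j * w l))) = 0"
    by (elim exE conjE)
  \<comment> \<open>The linear part of \<open>P\<close> below is \<open>\<kappa>\<close> times the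
    identity plus a rank-one map of trace \<open>sv\<close>; it is invertible when
    \<open>\<kappa>\<close> and \<open>\<kappa> + sv\<close> are nonzero. One of
    \<open>\<eta>\<close> and \<open>\<eta> / 2\<close> avoids the value
    \<open>- sv\<close>.\<close>
  define sv where "sv = (\<Sum>j<?n. v j)"
  obtain \<kappa> where \<kappa>: "\<kappa> > 0" "\<kappa> \<le> \<eta>" "of_real \<kappa> + sv \<noteq> 0"
  proof (cases "of_real \<eta> + sv = 0")
    case True
    then have "of_real (\<eta> / 2) + sv \<noteq> 0"
      using \<eta>(1) by (auto simp: add_eq_0_iff2)
    then show ?thesis
      using \<eta>(1) that[of "\<eta> / 2"] by simp
  next
    case False
    then show ?thesis
      using \<eta>(1) that[of \<eta>] by simp
  qed
  define e :: "nat \<Rightarrow> nat \<Rightarrow> complex" where "e i j = (if j = i then 1 else 0)" for i j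
  \<comment> \<open>Linear coordinates centred at \<open>z0\<close> whose axes have the directions
    \<open>v + \<kappa> * e i\<close>. These are within \<open>\<eta>\<close> of \<open>v\<close>,
    so lines parallel to the axes are among the nearby lines.\<close>
  define P where "P x = (\<lambda>j. z0 j + (\<Sum>i<?n. x i) * v j + of_real \<kappa> * x j)" for x :: "nat \<Rightarrow> complex"
  \<comment> \<open>\<open>Y\<close> bounds the displacement under \<open>P\<close>, so the polydisc
    of radius \<open>\<delta>\<close> lands within \<open>\<eta>\<close> of \<open>z0\<close>. The
    added units make \<open>Y \<ge> 1\<close>, hence \<open>\<delta> \<le> \<eta>\<close>.\<close>
  define Y where "Y = (1 + real ?n) * (?l v + \<eta> + 1)"
  define \<delta> where "\<delta> = \<eta> / Y"
  have "1 * 1 \<le> Y"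
    unfolding Y_def using \<eta>(1) by (intro mult_mono) auto
  then have den: "Y \<ge> 1" "Y > 0"
    by linarith+
  have \<delta>: "\<delta> > 0" "\<delta> \<le> \<eta>"
    using \<eta>(1) den by (simp_all add: \<delta>_def divide_le_eq_1 field_simps)
  let ?D = "ball (0::complex) \<delta>"
  have P_cspace: "P x \<in> cspace ?n" if "x \<in> cspace ?n" for x
    using that z0(1) v(1) by (auto simp: cspace_def P_def)
  have P_near: "?l (\<lambda>j. P x j - z0 j) \<le> \<eta>" if x: "x \<in> polydomain ?n ?D" for x
  proof -
    have lx: "?l x \<le> real ?n * \<delta>"
    proof -
      have "?l x \<le> (\<Sum>j<?n. \<delta>)"
        unfolding l1norm_def using x by (intro sum_mono) (auto simp: polydomain_def less_imp_le)
      then show ?thesis by simp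
    qed
    have "cmod (\<Sum>i<?n. x i) \<le> ?l x"
      unfolding l1norm_def by (rule norm_sum)
    then have "cmod (\<Sum>i<?n. x i) * ?l v \<le> ?l x * ?l v"
      by (intro mult_right_mono) auto
    moreover have "\<kappa> * ?l x \<le> \<eta> * ?l x"
      using \<kappa> by (intro mult_right_mono) auto
    moreover have "?l (\<lambda>j. P x j - z0 j) \<le> cmod (\<Sum>i<?n. x i) * ?l v + \<kappa> * ?l x"
      using l1norm_triangle[of ?n "\<lambda>j. (\<Sum>i<?n. x i) * v j" "\<lambda>j. of_real \<kappa> * x j"] \<kappa>(1)
      unfolding l1norm_scale by (simp add: P_def add.assoc)
    ultimately have "?l (\<lambda>j. P x j - z0 j) \<le> ?l x * (?l v + \<eta>)"
      unfolding distrib_left by (simp add: mult.commute)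
    also have "\<dots> \<le> (real ?n * \<delta>) * (?l v + \<eta>)"
      using lx \<eta>(1) by (intro mult_right_mono) auto
    also have "\<dots> \<le> ((1 + real ?n) * \<delta>) * (?l v + \<eta> + 1)"
      using \<eta>(1) \<delta>(1) by (intro mult_mono) auto
    also have "\<dots> = \<delta> * Y"
      by (simp add: Y_def)
    also have "\<dots> = \<eta>"
      using den(2) by (simp add: \<delta>_def)
    finally show ?thesis .
  qed
  have P_W: "P x \<in> W" if "x \<in> polydomain ?n ?D" for x
    using R(2)[OF P_cspace] P_near[OF that] \<eta>(2) that by (auto simp: polydomain_def)
  have P_upd: "P (x(i := t)) = (\<lambda>j. P (x(i := 0)) j + t * (v j + of_real \<kappa> * e i j))" if "i < ?n" for x i t
  proof -
    have *: "(\<Sum>k<?n. (x(i := s)) k) = s + (\<Sum>k\<in>{..<?n} - {i}. x k)" for s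
      using that by (subst sum.remove[of _ i]) (auto intro!: sum.cong)
    show ?thesis
      unfolding P_def * by (auto simp: fun_eq_iff e_def algebra_simps)
  qed
  define G where "G = (\<lambda>c x. affine_form ?m c (F (P x)))"
  have D0: "0 \<in> ?D"
    using \<delta>(1) by simp
  have "\<exists>S. S \<subseteq> polydomain ?n ?D \<and> finite S \<and> card S \<le> (B + 1) ^ ?n \<and>
    (\<forall>g\<in>range G. (\<forall>x\<in>S. g x = 0) \<longrightarrow> (\<forall>x\<in>polydomain ?n ?D. g x = 0))"
  proof (rule determining_set)
    show "open ?D" "connected ?D" "?D \<noteq> {}"
      using D0 by auto
  next
    fix g assume "g \<in> range G"
    then obtain c where g: "g = G c"
      by blast
    show "separately_holomorphic ?n ?D g"
      unfolding separately_holomorphic_def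
    proof (intro ballI allI impI)
      fix x i assume xi: "x \<in> polydomain ?n ?D" "i < ?n"
      define p where "p = P (x(i := 0))"
      have upd: "P (x(i := t)) = (\<lambda>j. p j + t * (v j + of_real \<kappa> * e i j))" for t
        unfolding p_def by (rule P_upd[OF xi(2)])
      show "(\<lambda>t. g (x(i := t))) holomorphic_on ?D"
        unfolding g G_def upd
      proof (rule g_hol)
        show "(\<lambda>j. p j + t * (v j + of_real \<kappa> * e i j)) \<in> W" if "t \<in> ?D" for t
          unfolding upd[symmetric] by (rule P_W[OF polydomain_upd[OF xi that]])
      qed simp
    qed
  next
    fix x i and gs :: "nat \<Rightarrow> (nat \<Rightarrow> complex) \<Rightarrow> complex" and ts :: "nat \<Rightarrow> complex"
    assume xi: "x \<in> polydomain ?n ?D" "i < ?n" and gs: "\<And>j. gs j \<in> range G" and ts: "\<And>j. ts j \<in> ?D"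
    have "\<forall>j. \<exists>c. gs j = G c"
      using gs by blast
    then obtain c where c: "\<And>j. gs j = G (c j)"
      by metis
    \<comment> \<open>The line is written from its point with coordinate \<open>i\<close> equal to
      0; the nodes \<open>ts\<close> are then its parameters and satisfy the smallness condition of
      \<open>lines\<close>.\<close>
    have x0: "x(i := 0) \<in> polydomain ?n ?D"
      by (rule polydomain_upd[OF xi D0])
    define p where "p = P (x(i := 0))"
    have upd: "P (x(i := t)) = (\<lambda>j. p j + t * (v j + of_real \<kappa> * e i j))" for t
      unfolding p_def by (rule P_upd[OF xi(2)])
    have "minor (B + 2) (\<lambda>j k. affine_form ?m (c j)
        (F (\<lambda>l. p l + ts k * (v l + of_real \<kappa> * e i l)))) = 0"
    proof (rule lines[rule_format])
      show "p \<in> cspace ?n"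
        using x0 unfolding p_def by (intro P_cspace) (simp only: polydomain_def mem_Collect_eq)
      show "(\<lambda>l. v l + of_real \<kappa> * e i l) \<in> cspace ?n"
        using v(1) xi(2) by (auto simp: cspace_def e_def)
      show "?l (\<lambda>l. p l - z0 l) \<le> \<eta>"
        unfolding p_def by (rule P_near[OF x0])
      have "?l (e i) = (\<Sum>j<?n. if j = i then 1 else 0)"
        unfolding l1norm_def e_def by (intro sum.cong) auto
      then have "?l (e i) = 1"
        using xi(2) by simp
      then show "?l (\<lambda>l. v l + of_real \<kappa> * e i l - v l) \<le> \<eta>"
        using \<kappa> by (simp add: l1norm_scale)
      show "cmod (ts j) < \<eta>" for j
        using ts[of j] \<delta>(2) by simp
    qed
    then show "minor (Suc (B + 1)) (\<lambda>j k. gs j (x(i := ts k))) = 0"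
      unfolding c G_def upd by simp
  qed
  then obtain S where S: "S \<subseteq> polydomain ?n ?D" "finite S" "card S \<le> (B + 1) ^ ?n"
    and det: "\<And>c x. (\<forall>x\<in>S. G c x = 0) \<Longrightarrow> x \<in> polydomain ?n ?D \<Longrightarrow> G c x = 0"
    by blast
  have "card ((\<lambda>x. F (P x)) ` S) < ?m + 1"
    using card_image_le[OF S(2), of "\<lambda>x. F (P x)"] S(3) large by linarith
  from affine_relation_on_finite_set[OF finite_imageI[OF S(2)] this]
  obtain c where c: "\<exists>k<?m + 1. c k \<noteq> 0" "\<And>x. x \<in> S \<Longrightarrow> affine_form ?m c (F (P x)) = 0"
    by blast
  have zero_box: "affine_form ?m c (F (P x)) = 0" if "x \<in> polydomain ?n ?D" for x
    using det[of c x] c(2) that by (simp add: G_def)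
  \<comment> \<open>\<open>C\<close> bounds the inverse of the linear part of \<open>P\<close>, so
    points within \<open>\<delta> / C\<close> of \<open>z0\<close> come from the polydisc.\<close>
  define C where "C = (1 + ?l v / cmod (of_real \<kappa> + sv)) / \<kappa>"
  have C: "C > 0"
    using \<kappa>(1) by (auto simp: C_def intro!: divide_pos_pos add_pos_nonneg)
  have zero_near: "affine_form ?m c (F y) = 0"
    if y: "y \<in> cspace ?n" "?l (\<lambda>j. y j - z0 j) < \<delta> / C" for y
  proof -
    \<comment> \<open>Solving \<open>P x = y\<close>: summing the coordinates determines
      \<open>\<sigma>\<close>, the sum of the \<open>x j\<close>, as the sum of the
      \<open>d j\<close> divided by \<open>\<kappa> + sv\<close>; then each \<open>x j\<close>
      follows.\<close>
    define d where "d j = y j - z0 j" for j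
    define \<sigma> where "\<sigma> = (\<Sum>j<?n. d j) / (of_real \<kappa> + sv)"
    define x where "x j = (d j - \<sigma> * v j) / of_real \<kappa>" for j
    have "(\<Sum>j<?n. x j) = ((\<Sum>j<?n. d j) - \<sigma> * sv) / of_real \<kappa>"
      unfolding x_def sv_def by (simp add: sum_divide_distrib[symmetric] sum_subtractf sum_distrib_left)
    also have "(\<Sum>j<?n. d j) = \<sigma> * (of_real \<kappa> + sv)"
      using \<kappa>(3) by (simp add: \<sigma>_def)
    finally have "(\<Sum>j<?n. x j) = \<sigma>"
      using \<kappa>(1) by (simp add: field_simps)
    then have "P x = y"
      using \<kappa>(1) by (simp add: P_def x_def d_def fun_eq_iff)
    have "x j \<in> ?D" if "j < ?n" for j
    proof -
      have "cmod \<sigma> \<le> ?l d / cmod (of_real \<kappa> + sv)"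
        unfolding \<sigma>_def norm_divide l1norm_def by (intro divide_right_mono norm_sum) auto
      then have "cmod \<sigma> * cmod (v j) \<le> ?l d / cmod (of_real \<kappa> + sv) * ?l v"
        using cmod_le_l1norm[OF that, of v] by (intro mult_mono) auto
      moreover have "cmod (d j - \<sigma> * v j) \<le> cmod (d j) + cmod \<sigma> * cmod (v j)"
        using norm_triangle_ineq4[of "d j" "\<sigma> * v j"] by (simp add: norm_mult)
      moreover have "cmod (d j) \<le> ?l d"
        by (rule cmod_le_l1norm[OF that])
      ultimately have "cmod (d j - \<sigma> * v j) \<le> ?l d * (1 + ?l v / cmod (of_real \<kappa> + sv))"
        by (simp add: algebra_simps)
      then have "cmod (x j) \<le> ?l d * C"
        unfolding x_def C_def norm_divide using \<kappa>(1) by (simp add: divide_right_mono)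
      also have "\<dots> < \<delta>"
        using y(2) C by (simp add: d_def[abs_def] pos_less_divide_eq)
      finally show ?thesis by simp
    qed
    moreover have "x \<in> cspace ?n"
      using y(1) z0(1) v(1) by (auto simp: cspace_def x_def d_def)
    ultimately have "x \<in> polydomain ?n ?D"
      by (simp add: polydomain_def)
    from zero_box[OF this] show ?thesis
      by (simp only: \<open>P x = y\<close>)
  qed
  have zero_U: "affine_form ?m c (F z) = 0" if "z \<in> U" for z
    by (rule vanishing_on_connected[where g = "\<lambda>z. affine_form ?m c (F z)" and W = W,
          OF g_hol W_ball U(2) U_cspace z0U _ zero_near that])
      (use \<delta>(1) C in auto)
  \<comment> \<open>With zero linear part the form would be the constant \<open>c ?m\<close>, which
    vanishes by evaluation at \<open>z0\<close>. So the linear part is nonzero and the zero set is a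
    hyperplane.\<close>
  have "\<exists>k<?m. c k \<noteq> 0"
  proof (rule ccontr)
    assume "\<not> (\<exists>k<?m. c k \<noteq> 0)"
    moreover have "c ?m = 0"
      using calculation zero_U[OF z0U] by (simp add: affine_form_def)
    ultimately show False
      using c(1) by (auto simp: less_Suc_eq)
  qed
  then obtain k where "k < ?m" "c k \<noteq> 0"
    by blast
  then have "complex_hyperplane ?m {w \<in> cspace ?m. affine_form ?m c w = 0}"
    by (rule complex_hyperplane_affine_form)
  moreover have "f ` U \<subseteq> {w \<in> cspace ?m. affine_form ?m c w = 0}"
    using fQ zero_U Ff by (auto simp: hyperquadric_iff)
  ultimately show False
    using nonflat by blast
qed

theorem theorem1p3:
  fixes a b B :: nat
  assumes "a > b" and "b \<ge> 1"
  shows "\<exists>N :: nat. \<forall>A :: nat. \<forall>U f.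
           U \<noteq> {} \<longrightarrow> connected U \<longrightarrow> openin (top_of_set (hyperquadric a b)) U \<longrightarrow>
           real_analytic_CR_map a b A B U f \<longrightarrow>
           \<not> (\<exists>H. complex_hyperplane (A + B) H \<and> f ` U \<subseteq> H) \<longrightarrow>
           A \<le> N"
proof (intro exI[of _ "(B + 1) ^ (a + b)"] allI impI)
  fix A U f
  assume "U \<noteq> {}" "connected U" "openin (top_of_set (hyperquadric a b)) U"
    "real_analytic_CR_map a b A B U f" "\<not> (\<exists>H. complex_hyperplane (A + B) H \<and> f ` U \<subseteq> H)"
  \<comment> \<open>From \<open>a > b\<close> and \<open>b \<ge> 1\<close> comes
    \<open>a \<ge> 2\<close>, which supplies the positive direction orthogonal to a base
    point.\<close>
  then have "A + B + 1 \<le> (B + 1) ^ (a + b)"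
    using assms by (intro real_analytic_CR_map_target_bound[of a b U A B f]) auto
  then show "A \<le> (B + 1) ^ (a + b)"
    by simp
qed

end
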